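(* There is an absolute constant $C$ such that the following holds for every ring of cliques $\mathcal{R}_{b,q}$, with $n=bq$ and normalized adjacency matrix $\hat{A}$. Let $\mathbf{x}_0$ be a random vector in $\mathbb{R}^n$ with independent standard normal entries, and let $\mathbf{x}_{k+1}=\hat{A}\mathbf{x}_k/\|\mathbf{x}_k\|$ for $k\ge0$ be the power method iterates. Let $$\zeta=\left(\frac{e^{7/8}}{8}\right)^{q/2}+\left(\frac{2}{e}\right)^{(n-q)/2}.$$ Then there is an integer $k^*$, depending only on $b$ and $q$, with $k^*\le C\max\{1,\log_b q\}$ (that is, $k^*$ is $O(\log_b q)$), such that for every $k\ge k^*$, a sweep cut based on $\mathbf{x}_k$ makes no errors, i.e. $\mathbf{x}_k$ recovers all the cliques of $\mathcal{R}_{b,q}$, with probability at least $1-\zeta$.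
   Context: For integers $b\ge 2$, $q\ge 3$, the ring of cliques $\mathcal{R}_{b,q}$ is the graph on vertices $1,\dots,n$ ($n=bq$) consisting of $q$ cliques $\{ib+1,\dots,ib+b\}$, $i=0,\dots,q-1$, with the corner vertices $ib+1$ joined cyclically to form a ring (cycle of length $q$). With $A$ its adjacency matrix and $D$ its diagonal degree matrix, $\hat{A}=D^{-1/2}AD^{-1/2}$. The vertex blocks are the sets of internal vertices $\mathcal{B}_i=\{ib+2,\dots,ib+b\}$. A vector $\mathbf{y}\in\mathbb{R}^n$ recovers all the cliques of $\mathcal{R}_{b,q}$ (a sweep cut based on it makes no errors) if there is a threshold $t\in(\min_i y_i,\max_i y_i)$ such that for every block $\mathcal{B}_i$ and all $j,k\in\mathcal{B}_i$: $y_j<t$ if and only if $y_k<t$. *)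

theory Defs
  imports "HOL-Probability.Probability"
begin

text \<open>
  Vectors in \<open>n\<close>-space and \<open>n \<times> n\<close> matrices are functions on \<open>nat\<close> whose indices are meant to range
  over the vertex set \<open>{1..n}\<close>, \<open>n = b * q\<close>; values at other indices never matter.
\<close>

definition ring_verts :: "nat \<Rightarrow> nat \<Rightarrow> nat set" where
  "ring_verts b q = {1..b * q}"

definition clique :: "nat \<Rightarrow> nat \<Rightarrow> nat set" where
  "clique b i = {i * b + 1..i * b + b}"

definition corner :: "nat \<Rightarrow> nat \<Rightarrow> nat" where
  "corner b i = i * b + 1"

definition vertex_block :: "nat \<Rightarrow> nat \<Rightarrow> nat set" where
  "vertex_block b i = {i * b + 2..i * b + b}"

definition ring_adj :: "nat \<Rightarrow> nat \<Rightarrow> nat \<Rightarrow> nat \<Rightarrow> bool" where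
  "ring_adj b q u v \<longleftrightarrow>
     (u \<noteq> v \<and> (\<exists>i<q. u \<in> clique b i \<and> v \<in> clique b i)) \<or>
     (\<exists>i<q. {u, v} = {corner b i, corner b ((i + 1) mod q)})"

definition adj_matrix :: "nat \<Rightarrow> nat \<Rightarrow> nat \<Rightarrow> nat \<Rightarrow> real" where
  "adj_matrix b q u v = (if ring_adj b q u v then 1 else 0)"

definition degree :: "nat \<Rightarrow> nat \<Rightarrow> nat \<Rightarrow> nat" where
  "degree b q u = card {v \<in> ring_verts b q. ring_adj b q u v}"

text \<open>The \<open>(u, v)\<close> entry of \<open>D\<^sup>-\<^sup>1\<^sup>/\<^sup>2 A D\<^sup>-\<^sup>1\<^sup>/\<^sup>2\<close>, where \<open>D\<close> is the diagonal matrix of the degrees.\<close>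

definition norm_adj_matrix :: "nat \<Rightarrow> nat \<Rightarrow> nat \<Rightarrow> nat \<Rightarrow> real" where
  "norm_adj_matrix b q u v =
     real (degree b q u) powr (-1/2) * adj_matrix b q u v * real (degree b q v) powr (-1/2)"

primrec power_iterate :: "nat \<Rightarrow> nat \<Rightarrow> (nat \<Rightarrow> real) \<Rightarrow> nat \<Rightarrow> nat \<Rightarrow> real" where
  "power_iterate b q x0 0 = x0"
| "power_iterate b q x0 (Suc k) =
     (\<lambda>u. (\<Sum>v\<in>ring_verts b q. norm_adj_matrix b q u v * power_iterate b q x0 k v) /
          L2_set (power_iterate b q x0 k) (ring_verts b q))"

definition recovers_cliques :: "nat \<Rightarrow> nat \<Rightarrow> (nat \<Rightarrow> real) \<Rightarrow> bool" where
  "recovers_cliques b q y \<longleftrightarrow>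
     (\<exists>t. Min (y ` ring_verts b q) < t \<and> t < Max (y ` ring_verts b q) \<and>
          (\<forall>i<q. \<forall>j\<in>vertex_block b i. \<forall>k\<in>vertex_block b i. y j < t \<longleftrightarrow> y k < t))"

text \<open>The law of a random vector, indexed by the vertices, with independent standard normal entries.\<close>

definition gaussian_vector :: "nat \<Rightarrow> nat \<Rightarrow> (nat \<Rightarrow> real) measure" where
  "gaussian_vector b q = PiM (ring_verts b q) (\<lambda>_. std_normal_distribution)"

definition failure_bound :: "nat \<Rightarrow> nat \<Rightarrow> real" where
  "failure_bound b q =
     (exp (7/8) / 8) powr (real q / 2) + (2 / exp 1) powr ((real (b * q) - real q) / 2)"

end

theory Submission
  imports Defs
begin

text \<open>
  Differences inside a vertex block are multiplied by \<open>-1/(b-1)\<close> in every step, so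
  \<open>x\<^sub>k\<close> recovers the cliques as soon as its spread over all vertices exceeds \<open>q + 1\<close> times this
  noise: of \<open>q + 1\<close> equally spaced thresholds, one is not hit by any of the \<open>q\<close> blocks.

  The spread could only be small compared with the norm if the iterate were close to a multiple of the
  all-ones vector. The latter is not orthogonal to the eigenvector (constant on corners and on internal
  vertices) with eigenvalue \<open>(b-3)/(b\<^sup>2-1)\<close>, and this component dies out quickly.

  That the norm is large is an anticoncentration statement. If two starting vectors differ only in one
  internal vertex per block and both have small \<open>k\<close>-th iterates, then they are close, because the block
  averages of their difference grow at least as fast as in the first step (log-convexity of the
  moments of a symmetric matrix). By Fubini, a bad set with this property has probability at most
  \<open>(1/2)\<^sup>q\<close>. The second term of \<open>\<zeta>\<close> pays for the event that some entry of the starting vector exceeds \<open>n\<close>.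
\<close>

subsection \<open>Iterates of symmetric matrices\<close>

definition mat_app :: "'a set \<Rightarrow> ('a \<Rightarrow> 'a \<Rightarrow> real) \<Rightarrow> ('a \<Rightarrow> real) \<Rightarrow> 'a \<Rightarrow> real" where
  "mat_app V H x = (\<lambda>u. \<Sum>v\<in>V. H u v * x v)"

lemma mat_app_pow_diff:
  "(mat_app V H ^^ k) (\<lambda>v. x v - y v) = (\<lambda>v. (mat_app V H ^^ k) x v - (mat_app V H ^^ k) y v)"
  by (induction k) (simp_all add: mat_app_def fun_eq_iff right_diff_distrib sum_subtractf)

lemma mat_app_pow_eigen:
  assumes eig: "\<And>v. v \<in> V \<Longrightarrow> mat_app V H x v = c * x v" and "u \<in> V"
  shows "(mat_app V H ^^ k) x u = c ^ k * x u"
  using assms(2)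
proof (induction k arbitrary: u)
  case (Suc k)
  have "(mat_app V H ^^ Suc k) x u = (\<Sum>v\<in>V. H u v * (c ^ k * x v))"
    by (simp add: mat_app_def[of V H "(mat_app V H ^^ k) x"] Suc.IH)
  also have "\<dots> = c ^ k * mat_app V H x u"
    by (simp add: mat_app_def sum_distrib_left mult_ac)
  finally show ?case using eig[OF Suc.prems] by simp
qed auto

lemma mat_app_pow_self_adjoint:
  assumes sym: "\<And>u v. H u v = H v u"
  shows "(\<Sum>u\<in>V. (mat_app V H ^^ k) x u * y u) = (\<Sum>u\<in>V. x u * (mat_app V H ^^ k) y u)"
proof (induction k arbitrary: x y)
  case (Suc k)
  have "(\<Sum>u\<in>V. (mat_app V H ^^ Suc k) x u * y u) =
      (\<Sum>u\<in>V. \<Sum>v\<in>V. H u v * (mat_app V H ^^ k) x v * y u)"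
    by (simp add: mat_app_def sum_distrib_right)
  also have "\<dots> = (\<Sum>v\<in>V. \<Sum>u\<in>V. H u v * (mat_app V H ^^ k) x v * y u)"
    by (rule sum.swap)
  also have "\<dots> = (\<Sum>v\<in>V. (mat_app V H ^^ k) x v * mat_app V H y v)"
    by (auto simp: mat_app_def sum_distrib_left sym mult_ac intro!: sum.cong)
  also have "\<dots> = (\<Sum>v\<in>V. x v * (mat_app V H ^^ k) (mat_app V H y) v)"
    by (rule Suc.IH)
  finally show ?case by (simp only: funpow_Suc_right o_apply)
qed auto

text \<open>Symmetry gives \<open>N (Suc k) = <H^k x, H^(k+2) x>\<close>, and Cauchy-Schwarz then
  bounds its square by \<open>N k * N (Suc (Suc k))\<close>. Hence the ratios of consecutive squared
  norms never decrease, and a lower bound on the first one persists.\<close>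

lemma norm_growth_step:
  assumes sym: "\<And>u v. H u v = H v u"
    and ratio: "m * (\<Sum>u\<in>V. (x u)\<^sup>2) \<le> (\<Sum>u\<in>V. (mat_app V H x u)\<^sup>2)"
  shows "m * (\<Sum>u\<in>V. ((mat_app V H ^^ k) x u)\<^sup>2) \<le> (\<Sum>u\<in>V. ((mat_app V H ^^ Suc k) x u)\<^sup>2)"
proof (induction k)
  case 0
  then show ?case using ratio by simp
next
  case (Suc k)
  define N where "N j = (\<Sum>u\<in>V. ((mat_app V H ^^ j) x u)\<^sup>2)" for j
  have N0: "N j \<ge> 0" for j unfolding N_def by (intro sum_nonneg) auto
  have "N (Suc k) = (\<Sum>u\<in>V. (mat_app V H ^^ 1) ((mat_app V H ^^ k) x) u * (mat_app V H ^^ Suc k) x u)"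
    by (simp add: N_def power2_eq_square)
  also have "\<dots> = (\<Sum>u\<in>V. (mat_app V H ^^ k) x u * (mat_app V H ^^ 1) ((mat_app V H ^^ Suc k) x) u)"
    by (rule mat_app_pow_self_adjoint[OF sym])
  finally have "(N (Suc k))\<^sup>2 = (\<Sum>u\<in>V. (mat_app V H ^^ k) x u * (mat_app V H ^^ Suc (Suc k)) x u)\<^sup>2"
    by simp
  also have "\<dots> \<le> N k * N (Suc (Suc k))"
    unfolding N_def by (rule Cauchy_Schwarz_ineq_sum)
  finally have cs: "(N (Suc k))\<^sup>2 \<le> N k * N (Suc (Suc k))" .
  have IH: "m * N k \<le> N (Suc k)" using Suc.IH by (simp add: N_def)
  have "m * N (Suc k) \<le> N (Suc (Suc k))"
  proof (cases "N (Suc k) = 0")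
    case True then show ?thesis using N0 by simp
  next
    case False
    then have "N (Suc k) > 0" using N0[of "Suc k"] by simp
    \<comment> \<open>If \<open>N k\<close> vanished, \<open>cs\<close> would force
      \<open>N (Suc k) = 0\<close>. So both norms are positive and the factor \<open>N k\<close> can
      be cancelled below.\<close>
    moreover have "N k \<noteq> 0" using cs False by auto
    then have "N k > 0" using N0[of k] by simp
    moreover have "N k * (m * N (Suc k)) \<le> N (Suc k) * N (Suc k)"
      using mult_right_mono[OF IH N0[of "Suc k"]] by (simp add: mult_ac)
    ultimately show ?thesis
      using cs by (smt (verit) mult_le_cancel_left_pos power2_eq_square)
  qed
  then show ?case by (simp add: N_def)
qed

text \<open>For symmetric \<open>H\<close> the squared norms of the iterates form a log-convex sequence, so the growth
  in the first step is a lower bound for the growth in every later step.\<close>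

lemma norm_growth:
  assumes sym: "\<And>u v. H u v = H v u" and "m \<ge> 0"
    and ratio: "m * (\<Sum>u\<in>V. (x u)\<^sup>2) \<le> (\<Sum>u\<in>V. (mat_app V H x u)\<^sup>2)"
  shows "m ^ k * (\<Sum>u\<in>V. (x u)\<^sup>2) \<le> (\<Sum>u\<in>V. ((mat_app V H ^^ k) x u)\<^sup>2)"
proof (induction k)
  case (Suc k)
  have "m ^ Suc k * (\<Sum>u\<in>V. (x u)\<^sup>2) \<le> m * (\<Sum>u\<in>V. ((mat_app V H ^^ k) x u)\<^sup>2)"
    using mult_left_mono[OF Suc \<open>m \<ge> 0\<close>] by (simp add: mult_ac)
  also have "\<dots> \<le> (\<Sum>u\<in>V. ((mat_app V H ^^ Suc k) x u)\<^sup>2)"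
    by (rule norm_growth_step[OF sym ratio])
  finally show ?case .
qed auto

subsection \<open>The ring of cliques\<close>

lemma clique_eq_insert_corner: "b \<ge> 1 \<Longrightarrow> clique b i = insert (corner b i) (vertex_block b i)"
  by (auto simp: clique_def corner_def vertex_block_def)

lemma corner_notin_block: "corner b i \<notin> vertex_block b i"
  by (auto simp: corner_def vertex_block_def)

lemma finite_vertex_block [simp]: "finite (vertex_block b i)"
  by (simp add: vertex_block_def)

lemma card_vertex_block [simp]: "card (vertex_block b i) = b - 1"
  by (simp add: vertex_block_def)

lemma finite_ring_verts [simp]: "finite (ring_verts b q)"
  by (simp add: ring_verts_def)

text \<open>Vertices are numbered from 1, so shifting by one makes the clique index a quotient;
  disjointness of the cliques and their covering of \<open>ring_verts\<close> both follow from
  this.\<close>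

lemma mem_clique_iff: "b \<ge> 1 \<Longrightarrow> v \<in> clique b i \<longleftrightarrow> v \<ge> 1 \<and> (v - 1) div b = i"
proof -
  assume b: "b \<ge> 1"
  have "v \<in> clique b i \<longleftrightarrow> v \<ge> 1 \<and> i * b \<le> v - 1 \<and> v - 1 < Suc i * b"
    by (auto simp: clique_def)
  also have "\<dots> \<longleftrightarrow> v \<ge> 1 \<and> (v - 1) div b = i"
    using b by (auto simp: div_nat_eqI div_le_mono dividend_less_times_div
       mult.commute intro!: div_nat_eqI)
  finally show ?thesis .
qed

lemma clique_unique: "b \<ge> 1 \<Longrightarrow> v \<in> clique b i \<Longrightarrow> v \<in> clique b j \<Longrightarrow> i = j"
  by (simp add: mem_clique_iff)

lemma ring_verts_UN: "b \<ge> 1 \<Longrightarrow> ring_verts b q = (\<Union>i<q. clique b i)"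
  by (auto simp: mem_clique_iff ring_verts_def div_less_iff_less_mult mult.commute)

lemma sum_ring_verts:
  fixes f :: "nat \<Rightarrow> real"
  assumes "b \<ge> 1"
  shows "sum f (ring_verts b q) = (\<Sum>i<q. f (corner b i) + sum f (vertex_block b i))"
proof -
  have "sum f (ring_verts b q) = (\<Sum>i<q. sum f (clique b i))"
    unfolding ring_verts_UN[OF assms]
    by (rule sum.UNION_disjoint) (use clique_unique[OF assms] in \<open>blast | simp add: clique_def\<close>)+
  then show ?thesis
    by (simp add: clique_eq_insert_corner[OF assms] corner_notin_block)
qed

lemma corner_eq_iff [simp]: "b \<ge> 1 \<Longrightarrow> corner b i = corner b j \<longleftrightarrow> i = j"
  by (simp add: corner_def)

section \<open>Neighbourhoods and degrees\<close>

lemma nbrs_internal: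
  assumes "b \<ge> 1" "i < q" "u \<in> vertex_block b i"
  shows "{v \<in> ring_verts b q. ring_adj b q u v} = clique b i - {u}"
proof -
  have u: "u \<in> clique b i" using assms by (simp add: clique_eq_insert_corner)
  have nc: "u \<noteq> corner b j" for j
    using assms u clique_unique[OF \<open>b \<ge> 1\<close> u, of j] corner_notin_block
    by (metis clique_eq_insert_corner insertI1)
  have "ring_adj b q u v \<longleftrightarrow> v \<in> clique b i - {u}" for v
  proof -
    have "(\<exists>j<q. u \<in> clique b j \<and> v \<in> clique b j) \<longleftrightarrow> v \<in> clique b i"
      using clique_unique[OF \<open>b \<ge> 1\<close> u] u \<open>i < q\<close> by blast
    moreover have "{u, v} \<noteq> {corner b j, corner b ((j + 1) mod q)}" for j
      using nc by (simp add: doubleton_eq_iff)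
    ultimately show ?thesis unfolding ring_adj_def by (simp only:) blast
  qed
  moreover have "v \<in> ring_verts b q" if "v \<in> clique b i" for v
    using that assms ring_verts_UN[of b q] by auto
  ultimately show ?thesis by blast
qed

lemma nbrs_corner:
  assumes "b \<ge> 1" "i < q" "q \<ge> 3"
  shows "{v \<in> ring_verts b q. ring_adj b q (corner b i) v} =
    vertex_block b i \<union> {corner b ((i + 1) mod q), corner b ((i + q - 1) mod q)}"
proof -
  let ?u = "corner b i"
  have u: "?u \<in> clique b i" using assms by (simp add: clique_eq_insert_corner)
  \<comment> \<open>The predecessor of \<open>i\<close> on the cycle; adding \<open>q\<close> before
    subtracting 1 avoids truncated subtraction at \<open>i = 0\<close>.\<close>
  define p where "p = (i + q - 1) mod q"
  have p: "p < q" using assms by (simp add: p_def)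
  have prev: "(j + 1) mod q = i \<longleftrightarrow> j = p" if "j < q" for j
    using that assms by (cases "i = 0"; cases "j + 1 = q") (auto simp: p_def mod_if)
  have A: "ring_adj b q ?u v \<longleftrightarrow> v \<in> vertex_block b i \<or> v = corner b ((i + 1) mod q) \<or> v = corner b p" for v
  proof -
    have "(?u \<noteq> v \<and> (\<exists>j<q. ?u \<in> clique b j \<and> v \<in> clique b j)) \<longleftrightarrow> v \<in> vertex_block b i"
      using u assms clique_unique[OF \<open>b \<ge> 1\<close> u] clique_eq_insert_corner[OF \<open>b \<ge> 1\<close>] corner_notin_block by auto
    moreover have "{?u, v} = {corner b j, corner b ((j + 1) mod q)} \<longleftrightarrow>
        j = i \<and> v = corner b ((i + 1) mod q) \<or> j = p \<and> v = corner b p" if "j < q" for j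
      unfolding doubleton_eq_iff corner_eq_iff[OF \<open>b \<ge> 1\<close>] using prev[OF that] by blast
    then have "(\<exists>j<q. {?u, v} = {corner b j, corner b ((j + 1) mod q)}) \<longleftrightarrow>
       v = corner b ((i + 1) mod q) \<or> v = corner b p"
      using p \<open>i < q\<close> by blast
    ultimately show ?thesis unfolding ring_adj_def by (simp only:)
  qed
  have c: "corner b j \<in> ring_verts b q" if "j < q" for j
    using that assms by (auto simp: ring_verts_UN clique_eq_insert_corner)
  have sub: "v \<in> ring_verts b q" if "v \<in> vertex_block b i" for v
    using assms that by (auto simp: ring_verts_UN clique_eq_insert_corner)
  have "(i + 1) mod q < q" using assms by simp
  then have nc: "corner b ((i + 1) mod q) \<in> ring_verts b q" by (rule c)
  show ?thesis
    unfolding p_def[symmetric] A using sub nc c[OF p] by (intro set_eqI) (simp del: corner_eq_iff, metis)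
qed

lemma degree_internal:
  assumes "b \<ge> 1" "i < q" "u \<in> vertex_block b i"
  shows "degree b q u = b - 1"
  using assms unfolding degree_def nbrs_internal[OF assms]
  by (simp add: clique_eq_insert_corner corner_notin_block card_insert_if card_Diff_singleton_if)

text \<open>On a cycle of length 2 the successor and the predecessor would coincide. Their
  distinctness is what gives a corner two ring neighbours, hence degree
  \<open>b + 1\<close>.\<close>

lemma ring_nbrs_distinct:
  assumes "i < q" "q \<ge> 3" shows "(i + 1) mod q \<noteq> (i + q - 1) mod (q::nat)"
  using assms by (cases "i = 0"; cases "i + 1 = q") (auto simp: mod_if)

lemma corner_notin_any_block: "b \<ge> 1 \<Longrightarrow> corner b j \<notin> vertex_block b i"
  by (metis clique_unique clique_eq_insert_corner corner_notin_block insertCI)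

lemma degree_corner:
  assumes "b \<ge> 1" "i < q" "q \<ge> 3"
  shows "degree b q (corner b i) = b + 1"
  using assms ring_nbrs_distinct[OF assms(2,3)] unfolding degree_def nbrs_corner[OF assms]
  by (simp add: card_Un_disjoint corner_notin_any_block card_insert_if)

lemma ring_adj_sym: "ring_adj b q u v \<longleftrightarrow> ring_adj b q v u"
  unfolding ring_adj_def insert_commute[of u v "{}"] by blast

lemma norm_adj_matrix_sym: "norm_adj_matrix b q u v = norm_adj_matrix b q v u"
  by (simp add: norm_adj_matrix_def adj_matrix_def ring_adj_sym[of b q u v])

text \<open>At \<open>d = 0\<close> both sides are 0 by convention, so no positivity of degrees has
  to be carried along.\<close>

lemma powr_neg_half: "real d powr (-1/2) = 1 / sqrt (real d)"
  by (cases "d = 0") (auto simp: powr_minus_divide powr_half_sqrt)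

text \<open>The linear step without the division by the norm. All estimates concern its powers;
  \<open>power_iterate_pos_scale\<close> transfers them to the normalized iterates.\<close>

abbreviation ring_step :: "nat \<Rightarrow> nat \<Rightarrow> (nat \<Rightarrow> real) \<Rightarrow> nat \<Rightarrow> real" where
  "ring_step b q \<equiv> mat_app (ring_verts b q) (norm_adj_matrix b q)"

section \<open>One linear step in coordinates\<close>

lemma ring_step_nbrs:
  "ring_step b q x u = (\<Sum>v | v \<in> ring_verts b q \<and> ring_adj b q u v.
     x v / (sqrt (degree b q u) * sqrt (degree b q v)))"
  unfolding mat_app_def norm_adj_matrix_def powr_neg_half adj_matrix_def
  by (rule sum.mono_neutral_cong_right) auto

lemma ring_step_internal:
  assumes "b \<ge> 2" "i < q" "q \<ge> 3" "u \<in> vertex_block b i"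
  shows "ring_step b q x u = x (corner b i) / (sqrt (real b - 1) * sqrt (real b + 1)) +
    (sum x (vertex_block b i) - x u) / (real b - 1)"
proof -
  have ne: "u \<noteq> corner b i" using assms corner_notin_block by auto
  have s: "clique b i - {u} = insert (corner b i) (vertex_block b i - {u})"
    using assms ne by (auto simp: clique_eq_insert_corner)
  have "ring_step b q x u =
      (\<Sum>v\<in>insert (corner b i) (vertex_block b i - {u}). x v / (sqrt (degree b q u) * sqrt (degree b q v)))"
    unfolding ring_step_nbrs using nbrs_internal[of b i q u] assms s by simp
  also have "\<dots> = x (corner b i) / (sqrt (degree b q u) * sqrt (degree b q (corner b i))) +
      (\<Sum>v\<in>vertex_block b i - {u}. x v / (sqrt (degree b q u) * sqrt (degree b q v)))"
    by (simp add: corner_notin_block)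
  also have "(\<Sum>v\<in>vertex_block b i - {u}. x v / (sqrt (degree b q u) * sqrt (degree b q v))) =
      (\<Sum>v\<in>vertex_block b i - {u}. x v / (real b - 1))"
    using assms by (intro sum.cong) (auto simp: degree_internal of_nat_diff)
  also have "\<dots> = (sum x (vertex_block b i) - x u) / (real b - 1)"
    using assms by (simp add: sum_divide_distrib[symmetric] sum_diff1)
  finally have "ring_step b q x u = x (corner b i) / (sqrt (degree b q u) * sqrt (degree b q (corner b i))) +
      (sum x (vertex_block b i) - x u) / (real b - 1)" .
  moreover have "real (degree b q u) = real b - 1" "real (degree b q (corner b i)) = real b + 1"
    using assms by (simp_all add: degree_internal[of b i q u] degree_corner of_nat_diff)
  ultimately show ?thesis by (simp only:)
qed

lemma ring_step_corner:
  assumes "b \<ge> 2" "i < q" "q \<ge> 3"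
  shows "ring_step b q x (corner b i) =
    (x (corner b ((i + 1) mod q)) + x (corner b ((i + q - 1) mod q))) / (real b + 1) +
    sum x (vertex_block b i) / (sqrt (real b - 1) * sqrt (real b + 1))"
proof -
  let ?g = "\<lambda>v. x v / (sqrt (degree b q (corner b i)) * sqrt (degree b q v))"
  have "ring_step b q x (corner b i) =
     sum ?g (vertex_block b i \<union> {corner b ((i + 1) mod q), corner b ((i + q - 1) mod q)})"
    unfolding ring_step_nbrs using assms by (subst nbrs_corner) auto
  also have "\<dots> = sum ?g (vertex_block b i) + (?g (corner b ((i + 1) mod q)) + ?g (corner b ((i + q - 1) mod q)))"
    using assms ring_nbrs_distinct[OF assms(2,3)]
    by (subst sum.union_disjoint) (auto simp: corner_notin_any_block)
  also have "sum ?g (vertex_block b i) = (\<Sum>v\<in>vertex_block b i. x v / (sqrt (real b - 1) * sqrt (real b + 1)))"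
  proof (rule sum.cong)
    fix v assume "v \<in> vertex_block b i"
    then have "real (degree b q v) = real b - 1" "real (degree b q (corner b i)) = real b + 1"
      using assms by (simp_all add: degree_internal[of b i q v] degree_corner of_nat_diff)
    then show "?g v = x v / (sqrt (real b - 1) * sqrt (real b + 1))" by simp
  qed simp
  finally have *: "ring_step b q x (corner b i) =
    (\<Sum>v\<in>vertex_block b i. x v / (sqrt (real b - 1) * sqrt (real b + 1))) +
    (?g (corner b ((i + 1) mod q)) + ?g (corner b ((i + q - 1) mod q)))" .
  have "?g (corner b j) = x (corner b j) / (real b + 1)" if "j < q" for j
    using assms that by (simp add: degree_corner add.commute)
  then have g: "?g (corner b ((i + 1) mod q)) = x (corner b ((i + 1) mod q)) / (real b + 1)"
    "?g (corner b ((i + q - 1) mod q)) = x (corner b ((i + q - 1) mod q)) / (real b + 1)"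
    using assms by auto
  show ?thesis
    unfolding * g sum_divide_distrib add_divide_distrib by (rule add.commute)
qed

subsection \<open>Spectral estimates on the ring of cliques\<close>

lemma ring_verts_cases:
  assumes "b \<ge> 1" "v \<in> ring_verts b q"
  obtains i where "i < q" "v = corner b i" | i where "i < q" "v \<in> vertex_block b i"
  using assms clique_eq_insert_corner[OF assms(1)] by (auto simp: ring_verts_UN)

text \<open>Two vertices of a block receive the same corner term and the same block sum; each omits
  only its own value. On subtraction everything cancels except these omitted values.\<close>

lemma ring_step_block_diff:
  assumes "b \<ge> 2" "q \<ge> 3" "i < q" "u \<in> vertex_block b i" "v \<in> vertex_block b i"
  shows "(ring_step b q ^^ k) x u - (ring_step b q ^^ k) x v = (- 1 / (real b - 1)) ^ k * (x u - x v)"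
proof (induction k)
  case (Suc k)
  have "(ring_step b q ^^ Suc k) x u - (ring_step b q ^^ Suc k) x v =
     (- 1 / (real b - 1)) * ((ring_step b q ^^ k) x u - (ring_step b q ^^ k) x v)"
    using assms by (simp add: ring_step_internal[of b i q] diff_divide_distrib algebra_simps)
  then show ?case unfolding Suc.IH by simp
qed auto

text \<open>The factor for the squared norm in one step, for vectors constant on each block and zero
  at the corners: the first summand is what reaches the corners, the second what stays in the
  blocks.\<close>

definition growth :: "nat \<Rightarrow> real" where
  "growth b = 1 / (real b + 1) + ((real b - 2) / (real b - 1))\<^sup>2"

text \<open>With zeros at the corners nothing travels along the ring edges in this step, so each
  clique evolves by itself, and all of them have the same ratio.\<close>

lemma block_constant_growth:
  assumes "b \<ge> 2" "q \<ge> 3"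
    and corner0: "\<And>i. i < q \<Longrightarrow> z (corner b i) = 0"
    and const: "\<And>i v. i < q \<Longrightarrow> v \<in> vertex_block b i \<Longrightarrow> z v = w i"
  shows "(\<Sum>u\<in>ring_verts b q. (ring_step b q z u)\<^sup>2) = growth b * (\<Sum>u\<in>ring_verts b q. (z u)\<^sup>2)"
proof -
  define B where "B = real b - 1"
  have B: "B \<ge> 1" "real (b - 1) = B" using assms by (auto simp: B_def)
  have sum_z: "sum z (vertex_block b i) = B * w i" if "i < q" for i
    using const[OF that] B by simp
  have int: "ring_step b q z v = (B - 1) / B * w i" if "i < q" "v \<in> vertex_block b i" for i v
    using that assms sum_z[OF that(1)] const[OF that] B
    by (simp add: ring_step_internal corner0 B_def[symmetric] field_simps)
  have cor: "ring_step b q z (corner b i) = B / (sqrt B * sqrt (real b + 1)) * w i" if "i < q" for i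
    using that assms sum_z[OF that] by (simp add: ring_step_corner corner0 B_def[symmetric])
  have "(\<Sum>u\<in>ring_verts b q. (ring_step b q z u)\<^sup>2) =
     (\<Sum>i<q. (B / (sqrt B * sqrt (real b + 1)) * w i)\<^sup>2 + B * ((B - 1) / B * w i)\<^sup>2)"
    using assms B cor int by (subst sum_ring_verts) (auto intro!: sum.cong)
  also have "\<dots> = (\<Sum>i<q. growth b * (B * (w i)\<^sup>2))"
  proof (rule sum.cong)
    fix i
    have "(B / (sqrt B * sqrt (real b + 1)) * w i)\<^sup>2 = B / (real b + 1) * (w i)\<^sup>2"
      using B by (simp add: power_mult_distrib power_divide) (simp add: power2_eq_square)
    moreover have "growth b = 1 / (real b + 1) + ((B - 1) / B)\<^sup>2"
      by (simp add: growth_def B_def)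
    moreover have "((B - 1) / B * w i)\<^sup>2 = ((B - 1) / B)\<^sup>2 * (w i)\<^sup>2"
      by (rule power_mult_distrib)
    ultimately show "(B / (sqrt B * sqrt (real b + 1)) * w i)\<^sup>2 + B * ((B - 1) / B * w i)\<^sup>2 =
        growth b * (B * (w i)\<^sup>2)"
      by (simp only: distrib_left distrib_right mult_ac) simp
  qed simp
  also have "\<dots> = growth b * (\<Sum>u\<in>ring_verts b q. (z u)\<^sup>2)"
    using assms B const corner0 by (subst sum_ring_verts) (auto simp: sum_distrib_left intro!: sum.cong)
  finally show ?thesis .
qed

lemma growth_nonneg: "growth b \<ge> 0"
  by (simp add: growth_def)

text \<open>A vector vanishing at the corners splits orthogonally into its block averages and a remainder
  in the eigenspace of \<open>-1/(b-1)\<close>; the averages carry the growth.\<close>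

lemma internal_growth:
  assumes b: "b \<ge> 2" and q: "q \<ge> 3"
    and corner0: "\<And>i. i < q \<Longrightarrow> d (corner b i) = 0"
  shows "growth b ^ k * (\<Sum>i<q. (sum d (vertex_block b i))\<^sup>2 / (real b - 1)) \<le>
    (\<Sum>u\<in>ring_verts b q. ((ring_step b q ^^ k) d u)\<^sup>2)"
proof -
  let ?V = "ring_verts b q" and ?A = "ring_step b q"
  define w where "w i = sum d (vertex_block b i) / (real b - 1)" for i
  \<comment> \<open>The block averages of \<open>d\<close>, extended by zero to the corners;
    \<open>(v - 1) div b\<close> is the index of the clique of \<open>v\<close>.\<close>
  define z where "z v = (if v = corner b ((v - 1) div b) then 0 else w ((v - 1) div b))" for v
  define e where "e v = d v - z v" for v
  define c where "c = - 1 / (real b - 1)"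
  have b1: "b \<ge> 1" using b by simp
  have zc: "z (corner b i) = 0" for i
    using b by (simp add: z_def corner_def)
  have zi: "z v = w i" if "v \<in> vertex_block b i" for v i
  proof -
    have "v \<in> clique b i" using that b by (simp add: clique_eq_insert_corner)
    then have "(v - 1) div b = i" using mem_clique_iff[OF b1] by simp
    moreover have "v \<noteq> corner b i" using that corner_notin_block by auto
    ultimately show ?thesis by (simp add: z_def)
  qed
  have sum_z: "sum z (vertex_block b i) = sum d (vertex_block b i)" for i
    using b by (simp add: zi w_def of_nat_diff)
  have sum_e: "sum e (vertex_block b i) = 0" for i
    by (simp add: e_def sum_subtractf sum_z)
  have ec: "e (corner b i) = 0" if "i < q" for i
    using that by (simp add: e_def zc corner0)
  \<comment> \<open>Zero corners and zero block sums leave only the term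
    \<open>- e v / (b - 1)\<close> at internal vertices, and nothing at corners.\<close>
  have step_e: "?A e v = c * e v" if vV: "v \<in> ?V" for v
  proof -
    obtain i where i: "i < q" "v = corner b i \<or> v \<in> vertex_block b i"
      using ring_verts_cases[OF b1 vV] by metis
    then show ?thesis
    proof (elim disjE)
      assume v: "v = corner b i"
      have "(i + 1) mod q < q" "(i + q - 1) mod q < q" using q by auto
      then show ?thesis
        using i b q unfolding v by (subst ring_step_corner) (simp_all only: ec sum_e, simp)
    next
      assume v: "v \<in> vertex_block b i"
      then show ?thesis
        using i b q by (subst ring_step_internal[of b i]) (simp_all add: ec sum_e c_def)
    qed
  qed
  define y where "y = (?A ^^ k) z"
  define f where "f = (?A ^^ k) e"
  have f: "f v = c ^ k * e v" if "v \<in> ?V" for v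
    unfolding f_def by (rule mat_app_pow_eigen[OF step_e that])
  have split: "(?A ^^ k) d v = y v + f v" for v
    unfolding y_def f_def e_def mat_app_pow_diff by simp
  have "(\<Sum>v\<in>?V. z v * e v) = (\<Sum>i<q. \<Sum>v\<in>vertex_block b i. w i * e v)"
    using b1 zc zi by (subst sum_ring_verts) (auto intro!: sum.cong)
  also have "\<dots> = 0" by (simp add: sum_distrib_left[symmetric] sum_e)
  finally have ze: "(\<Sum>v\<in>?V. z v * e v) = 0" .
  \<comment> \<open>Self-adjointness moves the power from \<open>z\<close> to \<open>e\<close>,
    where it acts as a scalar. So orthogonality of \<open>z\<close> and \<open>e\<close> survives
    all steps, and Pythagoras applies.\<close>
  have "(\<Sum>v\<in>?V. y v * e v) = (\<Sum>v\<in>?V. z v * f v)"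
    unfolding y_def f_def by (rule mat_app_pow_self_adjoint[OF norm_adj_matrix_sym])
  also have "\<dots> = c ^ k * (\<Sum>v\<in>?V. z v * e v)"
    unfolding sum_distrib_left by (rule sum.cong) (simp_all add: f)
  finally have ye: "(\<Sum>v\<in>?V. y v * e v) = 0" by (simp add: ze)
  have "(\<Sum>v\<in>?V. y v * f v) = c ^ k * (\<Sum>v\<in>?V. y v * e v)"
    unfolding sum_distrib_left by (rule sum.cong) (simp_all add: f)
  then have yf: "(\<Sum>v\<in>?V. y v * f v) = 0" by (simp add: ye)
  have "(\<Sum>v\<in>?V. ((?A ^^ k) d v)\<^sup>2) = (\<Sum>v\<in>?V. (y v)\<^sup>2) + 2 * (\<Sum>v\<in>?V. y v * f v) + (\<Sum>v\<in>?V. (f v)\<^sup>2)"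
    by (simp add: split power2_sum sum.distrib sum_distrib_left mult_ac)
  then have "(\<Sum>v\<in>?V. (y v)\<^sup>2) \<le> (\<Sum>v\<in>?V. ((?A ^^ k) d v)\<^sup>2)"
    by (simp add: yf sum_nonneg)
  moreover have "growth b ^ k * (\<Sum>v\<in>?V. (z v)\<^sup>2) \<le> (\<Sum>v\<in>?V. (y v)\<^sup>2)"
    unfolding y_def using block_constant_growth[OF b q, of z w] zc zi
    by (intro norm_growth norm_adj_matrix_sym growth_nonneg) simp
  moreover have "(\<Sum>v\<in>?V. (z v)\<^sup>2) = (\<Sum>i<q. (sum d (vertex_block b i))\<^sup>2 / (real b - 1))"
    using b by (subst sum_ring_verts)
      (auto simp: zc zi w_def of_nat_diff power2_eq_square intro!: sum.cong)
  ultimately show ?thesis by simp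
qed

text \<open>Vectors constant on corners and on internal vertices form an invariant plane. It
  contains the eigenvector of eigenvalue 1, with entries the square roots of the degrees; this is
  the vector of the plane orthogonal to it, scaled to have no denominators.\<close>

definition bottom_vec :: "nat \<Rightarrow> nat \<Rightarrow> real" where
  "bottom_vec b v = (if v = corner b ((v - 1) div b) then (real b - 1)\<^sup>2 * sqrt (real b + 1)
     else - ((real b + 1) * sqrt (real b - 1)))"

definition bottom_val :: "nat \<Rightarrow> real" where
  "bottom_val b = (real b - 3) / ((real b - 1) * (real b + 1))"

lemma bottom_vec_corner: "b \<ge> 1 \<Longrightarrow> bottom_vec b (corner b i) = (real b - 1)\<^sup>2 * sqrt (real b + 1)"
  by (simp add: bottom_vec_def corner_def)

lemma bottom_vec_internal:
  assumes "b \<ge> 1" "v \<in> vertex_block b i"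
  shows "bottom_vec b v = - ((real b + 1) * sqrt (real b - 1))"
proof -
  have "v \<in> clique b i" using assms by (simp add: clique_eq_insert_corner)
  then have "(v - 1) div b = i" using mem_clique_iff[OF assms(1)] by simp
  moreover have "v \<noteq> corner b i" using assms corner_notin_block by auto
  ultimately show ?thesis by (simp add: bottom_vec_def)
qed

lemma ring_step_bottom_vec:
  assumes b: "b \<ge> 2" and q: "q \<ge> 3" and v: "v \<in> ring_verts b q"
  shows "ring_step b q (bottom_vec b) v = bottom_val b * bottom_vec b v"
proof -
  \<comment> \<open>In these variables both eigenvalue equations become rational identities modulo
    \<open>t\<^sup>2 = s\<^sup>2 + 2\<close>.\<close>
  define s t where "s = sqrt (real b - 1)" and "t = sqrt (real b + 1)"
  have st: "s\<^sup>2 = real b - 1" "t\<^sup>2 = real b + 1" "s > 0" "t > 0"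
    using b by (auto simp: s_def t_def)
  have cor: "bottom_vec b (corner b i) = s ^ 4 * t" for i
  proof -
    have "s ^ 4 = (real b - 1)\<^sup>2" unfolding st(1)[symmetric] by (simp flip: power_mult)
    then show ?thesis using b by (simp add: bottom_vec_corner t_def)
  qed
  have int: "bottom_vec b v = - (t\<^sup>2 * s)" if "v \<in> vertex_block b i" for i v
    using bottom_vec_internal[OF _ that] b st by (simp add: s_def)
  have sum: "sum (bottom_vec b) (vertex_block b i) = - (s\<^sup>2 * t\<^sup>2 * s)" for i
    using b st by (simp add: int of_nat_diff)
  have t2: "t\<^sup>2 = s\<^sup>2 + 2" using st by simp
  have val: "bottom_val b = (s\<^sup>2 - 2) / (s\<^sup>2 * t\<^sup>2)"
    using st by (simp add: bottom_val_def)
  from b have "b \<ge> 1" by simp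
  then show ?thesis using v
  proof (cases rule: ring_verts_cases)
    case (1 i)
    have "ring_step b q (bottom_vec b) v = (s ^ 4 * t + s ^ 4 * t) / t\<^sup>2 + (- (s\<^sup>2 * t\<^sup>2 * s)) / (s * t)"
      using b q 1 unfolding 1 by (subst ring_step_corner) (simp_all only: cor sum st s_def[symmetric] t_def[symmetric])
    also have "\<dots> = (2 * s ^ 4 - s\<^sup>2 * t\<^sup>2) / t"
      using st(3,4) by (simp add: field_simps power2_eq_square)
    also have "2 * s ^ 4 - s\<^sup>2 * t\<^sup>2 = s\<^sup>2 * (s\<^sup>2 - 2)"
      unfolding t2 by (simp add: algebra_simps power2_eq_square power4_eq_xxxx)
    also have "s\<^sup>2 * (s\<^sup>2 - 2) / t = (s\<^sup>2 - 2) / (s\<^sup>2 * t\<^sup>2) * (s ^ 4 * t)"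
      using st(3,4) by (simp add: field_simps power2_eq_square power4_eq_xxxx)
    finally show ?thesis using 1 by (simp add: cor val)
  next
    case (2 i)
    have "ring_step b q (bottom_vec b) v = (s ^ 4 * t) / (s * t) + (- (s\<^sup>2 * t\<^sup>2 * s) - (- (t\<^sup>2 * s))) / s\<^sup>2"
      using b q 2 by (subst ring_step_internal[of b i]) (simp_all only: cor sum int st s_def[symmetric] t_def[symmetric])
    also have "\<dots> = (s ^ 4 - (s\<^sup>2 - 1) * t\<^sup>2) / s"
      using st(3,4) by (simp add: field_simps power2_eq_square power4_eq_xxxx)
    also have "s ^ 4 - (s\<^sup>2 - 1) * t\<^sup>2 = - (s\<^sup>2 - 2)"
      unfolding t2 by (simp add: algebra_simps power2_eq_square power4_eq_xxxx)
    also have "- (s\<^sup>2 - 2) / s = (s\<^sup>2 - 2) / (s\<^sup>2 * t\<^sup>2) * (- (t\<^sup>2 * s))"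
      using st(3,4) by (simp add: field_simps power2_eq_square)
    finally show ?thesis using int[OF 2(2)] by (simp add: val)
  qed
qed

lemma abs_bottom_vec_le:
  assumes b: "b \<ge> 2" and v: "v \<in> ring_verts b q"
  shows "\<bar>bottom_vec b v\<bar> \<le> real b ^ 3"
proof -
  have r: "real b \<ge> 2" using b by simp
  have "real b + 1 \<le> real b * real b" using mult_right_mono[OF r, of "real b"] r by linarith
  then have s: "sqrt (real b + 1) \<le> real b" "sqrt (real b - 1) \<le> real b"
    using r by (auto intro!: real_le_lsqrt simp: power2_eq_square)
  from b have "b \<ge> 1" by simp
  then show ?thesis using v
  proof (cases rule: ring_verts_cases)
    case (1 i)
    have "(real b - 1)\<^sup>2 * sqrt (real b + 1) \<le> (real b)\<^sup>2 * real b"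
      using r s by (intro mult_mono power_mono) auto
    then show ?thesis using 1 b by (simp add: bottom_vec_corner abs_mult power3_eq_cube power2_eq_square)
  next
    case (2 i)
    have "(real b + 1) * sqrt (real b - 1) \<le> (real b * real b) * real b"
      using r s \<open>real b + 1 \<le> real b * real b\<close> by (intro mult_mono) auto
    moreover have "bottom_vec b v = - ((real b + 1) * sqrt (real b - 1))"
      using 2 b by (intro bottom_vec_internal) auto
    then have "\<bar>bottom_vec b v\<bar> = (real b + 1) * sqrt (real b - 1)"
      using r by (simp add: abs_mult)
    ultimately show ?thesis by (simp only: power3_eq_cube)
  qed
qed

text \<open>Non-orthogonality to the all-ones vector, made quantitative. Up to sign the sum is
  \<open>q * s^3 * t * (t - s)\<close>; from \<open>(t - s) * (t + s) = 2\<close> and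
  \<open>s <= t\<close> it follows that \<open>t * (t - s) >= 1\<close>.\<close>

lemma abs_sum_bottom_vec_ge:
  assumes b: "b \<ge> 2" and q: "q \<ge> 1"
  shows "\<bar>sum (bottom_vec b) (ring_verts b q)\<bar> \<ge> 1"
proof -
  define s t where "s = sqrt (real b - 1)" and "t = sqrt (real b + 1)"
  have st: "s\<^sup>2 = real b - 1" "t\<^sup>2 = real b + 1" "s \<ge> 1" "t \<ge> 1" "s \<le> t"
    using b by (auto simp: s_def t_def)
  have cor: "bottom_vec b (corner b i) = s ^ 4 * t" for i
  proof -
    have "s ^ 4 = (real b - 1)\<^sup>2" unfolding st(1)[symmetric] by (simp flip: power_mult)
    then show ?thesis using b by (simp add: bottom_vec_corner t_def)
  qed
  have int: "bottom_vec b v = - (t\<^sup>2 * s)" if "v \<in> vertex_block b i" for i v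
    using bottom_vec_internal[OF _ that] b st by (simp add: s_def)
  have sum: "sum (bottom_vec b) (vertex_block b i) = - (s\<^sup>2 * (t\<^sup>2 * s))" for i
    using b st by (simp add: int of_nat_diff)
  have "sum (bottom_vec b) (ring_verts b q) = real q * (s ^ 4 * t - s\<^sup>2 * (t\<^sup>2 * s))"
    using b cor by (subst sum_ring_verts) (simp_all add: sum)
  also have "\<dots> = - (real q * (s ^ 3 * (t * (t - s))))"
    by (simp add: algebra_simps power2_eq_square power3_eq_cube power4_eq_xxxx)
  finally have eq: "\<bar>sum (bottom_vec b) (ring_verts b q)\<bar> = real q * (s ^ 3 * (t * (t - s)))"
    using st by simp
  have "(t - s) * (t + s) = 2" using st by (simp add: algebra_simps power2_eq_square)
  moreover have "(t - s) * (t + s) \<le> (t - s) * (2 * t)"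
    using st by (intro mult_left_mono) auto
  ultimately have "1 \<le> t * (t - s)" by (simp add: algebra_simps)
  moreover have "1 \<le> s ^ 3" using st by simp
  ultimately have "1 \<le> s ^ 3 * (t * (t - s))"
    using mult_mono[of 1 "s ^ 3" 1 "t * (t - s)"] by linarith
  then have "1 * 1 \<le> real q * (s ^ 3 * (t * (t - s)))"
    using q by (intro mult_mono) auto
  then show ?thesis unfolding eq by simp
qed

subsection \<open>A deterministic criterion for recovery\<close>

text \<open>The iterate differs from the constant \<open>y 1\<close> by at most \<open>R\<close>.
  Pairing it with \<open>bottom_vec\<close> isolates \<open>y 1\<close>: the pairing with the
  iterate itself carries the factor \<open>bottom_val b ^ k\<close>, and the deviation from the
  constant contributes a multiple of \<open>R\<close>.\<close>

lemma iterate_norm_le_spread: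
  assumes b: "b \<ge> 2" and q: "q \<ge> 3"
    and bounded: "\<And>v. v \<in> ring_verts b q \<Longrightarrow> \<bar>x v\<bar> \<le> M"
    and spread: "\<And>u v. u \<in> ring_verts b q \<Longrightarrow> v \<in> ring_verts b q \<Longrightarrow>
      (ring_step b q ^^ k) x u - (ring_step b q ^^ k) x v \<le> R"
  shows "L2_set ((ring_step b q ^^ k) x) (ring_verts b q) \<le>
    real (b * q) * (real (b * q) * real b ^ 3 * (\<bar>bottom_val b\<bar> ^ k * M + R) + R)"
proof -
  let ?V = "ring_verts b q"
  define y where "y = (ring_step b q ^^ k) x"
  define N where "N = real (b * q)"
  have cardV: "real (card ?V) = N" by (simp add: ring_verts_def N_def)
  have "1 \<in> ?V" using b q by (simp add: ring_verts_def)
  have N1: "N \<ge> 1" using b q by (simp add: N_def mult_ge1_I)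
  have spread': "\<bar>y v - y 1\<bar> \<le> R" if "v \<in> ?V" for v
    using spread[OF that \<open>1 \<in> ?V\<close>] spread[OF \<open>1 \<in> ?V\<close> that] by (simp add: y_def)
  have R0: "R \<ge> 0" using spread'[OF \<open>1 \<in> ?V\<close>] by simp
  have M0: "M \<ge> 0" using bounded[OF \<open>1 \<in> ?V\<close>] by linarith
  have inner_bound: "\<bar>\<Sum>v\<in>?V. bottom_vec b v * f v\<bar> \<le> N * (real b ^ 3 * K)"
    if "\<And>v. v \<in> ?V \<Longrightarrow> \<bar>f v\<bar> \<le> K" for f K
  proof -
    have "\<bar>\<Sum>v\<in>?V. bottom_vec b v * f v\<bar> \<le> (\<Sum>v\<in>?V. real b ^ 3 * K)"
      by (rule order_trans[OF sum_abs sum_mono], unfold abs_mult)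
        (intro mult_mono abs_bottom_vec_le b that; simp)
    then show ?thesis by (simp add: cardV)
  qed
  have "(\<Sum>v\<in>?V. bottom_vec b v * y v) = (\<Sum>v\<in>?V. (ring_step b q ^^ k) (bottom_vec b) v * x v)"
    unfolding y_def by (rule mat_app_pow_self_adjoint[OF norm_adj_matrix_sym, symmetric])
  also have "\<dots> = bottom_val b ^ k * (\<Sum>v\<in>?V. bottom_vec b v * x v)"
    unfolding sum_distrib_left
    by (rule sum.cong) (simp_all add: mat_app_pow_eigen[OF ring_step_bottom_vec[OF b q]])
  finally have "\<bar>\<Sum>v\<in>?V. bottom_vec b v * y v\<bar> \<le> \<bar>bottom_val b\<bar> ^ k * (N * (real b ^ 3 * M))"
    using inner_bound[OF bounded] by (simp add: abs_mult power_abs mult_left_mono)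
  moreover have "\<bar>\<Sum>v\<in>?V. bottom_vec b v * (y v - y 1)\<bar> \<le> N * (real b ^ 3 * R)"
    by (rule inner_bound[OF spread'])
  moreover have "y 1 * (\<Sum>v\<in>?V. bottom_vec b v) =
      (\<Sum>v\<in>?V. bottom_vec b v * y v) - (\<Sum>v\<in>?V. bottom_vec b v * (y v - y 1))"
    by (simp add: right_diff_distrib sum_subtractf sum_distrib_left mult.commute)
  ultimately have "\<bar>y 1 * (\<Sum>v\<in>?V. bottom_vec b v)\<bar> \<le> N * real b ^ 3 * (\<bar>bottom_val b\<bar> ^ k * M + R)"
    by (simp add: algebra_simps)
  moreover have "\<bar>y 1\<bar> * 1 \<le> \<bar>y 1\<bar> * \<bar>\<Sum>v\<in>?V. bottom_vec b v\<bar>"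
    using abs_sum_bottom_vec_ge[of b q] b q by (intro mult_left_mono) auto
  ultimately have y1: "\<bar>y 1\<bar> \<le> N * real b ^ 3 * (\<bar>bottom_val b\<bar> ^ k * M + R)"
    by (simp add: abs_mult)
  have "L2_set y ?V \<le> (\<Sum>v\<in>?V. \<bar>y v\<bar>)" by (rule L2_set_le_sum_abs)
  also have "\<dots> \<le> (\<Sum>v\<in>?V. \<bar>y 1\<bar> + R)"
  proof (rule sum_mono)
    fix v assume "v \<in> ?V"
    from spread'[OF this] show "\<bar>y v\<bar> \<le> \<bar>y 1\<bar> + R" by linarith
  qed
  also have "\<dots> = N * (\<bar>y 1\<bar> + R)" by (simp add: cardV)
  also have "\<dots> \<le> N * (N * real b ^ 3 * (\<bar>bottom_val b\<bar> ^ k * M + R) + R)"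
    using y1 N1 by (intro mult_left_mono) auto
  finally show ?thesis by (simp add: y_def N_def)
qed

lemma recovers_cliquesI:
  assumes b: "b \<ge> 1" and uv: "u \<in> ring_verts b q" "v \<in> ring_verts b q"
    and tau: "\<And>i j l. i < q \<Longrightarrow> j \<in> vertex_block b i \<Longrightarrow> l \<in> vertex_block b i \<Longrightarrow> y j - y l \<le> \<tau>"
    and gap: "y u - y v > (real q + 1) * \<tau>" "y u > y v"
  shows "recovers_cliques b q y"
proof -
  let ?V = "ring_verts b q"
  define h where "h = (y u - y v) / (real q + 1)"
  \<comment> \<open>Midpoints of the \<open>q + 1\<close> equal pieces of the interval from
    \<open>y v\<close> to \<open>y u\<close>, so that every threshold lies strictly inside.\<close>
  define t where "t m = y v + (real m + 1/2) * h" for m :: nat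
  have h: "h > \<tau>" "h > 0"
    using gap by (simp_all add: h_def less_divide_eq mult.commute)
  have hq: "h * (real q + 1) = y u - y v" by (simp add: h_def)
  have "\<exists>m\<in>{..q}. \<forall>i<q. \<forall>j\<in>vertex_block b i. \<forall>l\<in>vertex_block b i. y j < t m \<longleftrightarrow> y l < t m"
  proof (rule ccontr)
    assume "\<not> ?thesis"
    then have "\<forall>m\<in>{..q}. \<exists>i. i < q \<and> (\<exists>j\<in>vertex_block b i. \<exists>l\<in>vertex_block b i. y j < t m \<and> t m \<le> y l)"
      by (meson not_le_imp_less)
    from bchoice[OF this] obtain i where "\<forall>m\<in>{..q}. i m < q \<and>
      (\<exists>j\<in>vertex_block b (i m). \<exists>l\<in>vertex_block b (i m). y j < t m \<and> t m \<le> y l)" ..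
    then have i: "\<And>m. m \<le> q \<Longrightarrow> i m < q"
      "\<And>m. m \<le> q \<Longrightarrow> \<exists>j\<in>vertex_block b (i m). \<exists>l\<in>vertex_block b (i m). y j < t m \<and> t m \<le> y l"
      by auto
    \<comment> \<open>If each of the \<open>q + 1\<close> thresholds split some block, two of them
      would split the same one, whose spread would then be at least
      \<open>h > \<tau>\<close>.\<close>
    have "\<not> inj_on i {..q}"
    proof (rule pigeonhole)
      have "i ` {..q} \<subseteq> {..<q}" using i(1) by auto
      from card_mono[OF _ this] show "card (i ` {..q}) < card {..q}" by simp
    qed
    then obtain m m' where m: "m \<le> q" "m' \<le> q" "m < m'" "i m = i m'"
      unfolding inj_on_def by (metis atMost_iff linorder_neqE_nat)
    obtain j where j: "j \<in> vertex_block b (i m)" "y j < t m" using i(2)[OF m(1)] by blast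
    obtain l where l: "l \<in> vertex_block b (i m)" "t m' \<le> y l" using i(2)[OF m(2)] m(4) by auto
    have "y l - y j \<le> \<tau>" using tau i(1)[OF m(1)] j l by blast
    then have "t m' - t m < \<tau>" using j l by linarith
    moreover have "t m' - t m = (real m' - real m) * h" by (simp add: t_def algebra_simps)
    moreover have "1 * h \<le> (real m' - real m) * h" using m(3) h by (intro mult_right_mono) auto
    ultimately show False using h by linarith
  qed
  then obtain m where m: "m \<le> q"
    "\<forall>i<q. \<forall>j\<in>vertex_block b i. \<forall>l\<in>vertex_block b i. y j < t m \<longleftrightarrow> y l < t m" by auto
  have "Min (y ` ?V) \<le> y v" "y u \<le> Max (y ` ?V)" using uv by auto
  moreover have "y v < t m" using h by (simp add: t_def)
  moreover have "(real m + 1/2) * h < (real q + 1) * h" using m(1) h by (intro mult_strict_right_mono) auto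
  then have "t m < y u" using hq by (simp add: t_def algebra_simps)
  ultimately have "Min (y ` ?V) < t m" "t m < Max (y ` ?V)" by linarith+
  with m(2) show ?thesis unfolding recovers_cliques_def by (intro exI conjI)
qed

text \<open>A zero iterate stays zero, so a nonzero \<open>k\<close>-th iterate guarantees that all
  norms divided by earlier are positive. Normalization then only rescales by a positive
  factor.\<close>

lemma power_iterate_pos_scale:
  assumes "\<exists>v\<in>ring_verts b q. (ring_step b q ^^ k) x v \<noteq> 0"
  shows "\<exists>c>0. power_iterate b q x k = (\<lambda>v. c * (ring_step b q ^^ k) x v)"
  using assms
proof (induction k)
  case 0
  show ?case by (intro exI[of _ 1]) simp
next
  case (Suc k)
  let ?V = "ring_verts b q"
  have ne: "\<exists>v\<in>?V. (ring_step b q ^^ k) x v \<noteq> 0"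
  proof (rule ccontr)
    assume "\<not> ?thesis"
    then have "(ring_step b q ^^ Suc k) x v = 0" for v by (simp add: mat_app_def)
    with Suc.prems show False by auto
  qed
  from Suc.IH[OF this] obtain c where c: "c > 0"
    "power_iterate b q x k = (\<lambda>v. c * (ring_step b q ^^ k) x v)" by blast
  define L where "L = L2_set (power_iterate b q x k) ?V"
  have "L \<noteq> 0" using ne c by (auto simp: L_def L2_set_eq_0_iff)
  moreover have "L \<ge> 0" unfolding L_def by (rule L2_set_nonneg)
  ultimately have "L > 0" by simp
  moreover have "power_iterate b q x (Suc k) = (\<lambda>u. c / L * (ring_step b q ^^ Suc k) x u)"
    unfolding power_iterate.simps L_def[symmetric]
    by (simp add: c(2) mat_app_def sum_distrib_left sum_divide_distrib mult_ac fun_eq_iff)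
  ultimately show ?case using c(1) by (intro exI[of _ "c / L"]) auto
qed

definition mu :: "nat \<Rightarrow> real" where "mu b = sqrt (growth b)"

text \<open>The power 12 absorbs all polynomial losses: a spread of at most
  \<open>(q + 1) * T\<close> would bound the norm by \<open>5 * mu b ^ k / N ^ 3\<close>,
  contradicting \<open>large\<close>. Hypothesis \<open>inner\<close> is restricted to
  \<open>b >= 3\<close> because for \<open>b = 2\<close> its left side is 1; there the blocks are
  single vertices.\<close>

lemma recovers_cliques_power_iterate:
  assumes b: "b \<ge> 2" and q: "q \<ge> 3"
    and bounded: "\<And>v. v \<in> ring_verts b q \<Longrightarrow> \<bar>x v\<bar> \<le> real (b * q)"
    and large: "L2_set ((ring_step b q ^^ k) x) (ring_verts b q) > mu b ^ k / (4 * real b)"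
    and mu: "mu b > 0"
    and bottom: "\<bar>bottom_val b\<bar> ^ k \<le> mu b ^ k / real (b * q) ^ 12"
    and inner: "b \<ge> 3 \<Longrightarrow> (1 / (real b - 1)) ^ k \<le> mu b ^ k / real (b * q) ^ 12"
  shows "recovers_cliques b q (power_iterate b q x k)"
proof -
  let ?V = "ring_verts b q"
  define y where "y = (ring_step b q ^^ k) x"
  define N where "N = real (b * q)"
  \<comment> \<open>The noise inside a block: initial differences are at most \<open>2 * N\<close>,
    and \<open>inner\<close> multiplies them by at most \<open>mu b ^ k / N ^ 12\<close>.\<close>
  define T where "T = 2 * mu b ^ k / N ^ 11"
  define P where "P = mu b ^ k"
  have P: "P > 0" using mu by (simp add: P_def)
  have bN: "3 * real b \<le> N" using q by (simp add: N_def mult.commute mult_left_mono)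
  have qN: "real q + 1 \<le> N"
  proof -
    have "2 * real q \<le> real b * real q" using b by (intro mult_right_mono) auto
    then show ?thesis using q unfolding N_def of_nat_mult by linarith
  qed
  have N6: "N \<ge> 6" using bN b by linarith
  have T0: "T > 0" using P N6 by (simp add: T_def P_def)
  have block: "\<bar>y j - y l\<bar> \<le> T" if "i < q" "j \<in> vertex_block b i" "l \<in> vertex_block b i" for i j l
  proof (cases "b = 2")
    case True
    then have "j = l" using that by (auto simp: vertex_block_def)
    then show ?thesis using T0 by simp
  next
    case False
    have "vertex_block b i \<subseteq> ?V"
      using that b clique_eq_insert_corner[of b i] by (auto simp: ring_verts_UN)
    then have "\<bar>x j\<bar> \<le> N" "\<bar>x l\<bar> \<le> N" using bounded that by (auto simp: N_def)
    then have xd: "\<bar>x j - x l\<bar> \<le> 2 * N" by linarith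
    have "\<bar>y j - y l\<bar> = (1 / (real b - 1)) ^ k * \<bar>x j - x l\<bar>"
      unfolding y_def ring_step_block_diff[OF b q that] using b by (simp add: abs_mult power_abs)
    also have "\<dots> \<le> (P / N ^ 12) * (2 * N)"
      using inner False b xd P N6 by (intro mult_mono) (auto simp: N_def P_def)
    also have "\<dots> = T" using N6 by (simp add: T_def P_def field_simps power_numeral_reduce)
    finally show ?thesis .
  qed
  have "\<exists>u\<in>?V. \<exists>v\<in>?V. y u - y v > (real q + 1) * T"
  proof (rule ccontr)
    assume "\<not> ?thesis"
    then have "y u - y v \<le> (real q + 1) * T" if "u \<in> ?V" "v \<in> ?V" for u v
      using that by (meson not_le)
    moreover have "(real q + 1) * T \<le> N * T" using qN T0 by (intro mult_right_mono) auto
    ultimately have sp: "y u - y v \<le> N * T" if "u \<in> ?V" "v \<in> ?V" for u v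
      using that order_trans by blast
    have "L2_set y ?V \<le> N * (N * real b ^ 3 * (\<bar>bottom_val b\<bar> ^ k * N + N * T) + N * T)"
      unfolding y_def N_def using sp bounded
      by (intro iterate_norm_le_spread b q) (auto simp: y_def N_def)
    also have "\<dots> \<le> N * (N * N ^ 3 * (P / N ^ 12 * N + N * T) + N * T)"
      using bottom bN N6 T0 P unfolding P_def[symmetric] N_def[symmetric]
      by (intro mult_left_mono add_mono mult_mono power_mono mult_right_mono) auto
    also have "\<dots> = P * (1 / N ^ 6 + 2 / N ^ 5 + 2 / N ^ 9)"
      using N6 by (simp add: T_def P_def[symmetric] field_simps power_numeral_reduce)
    also have "\<dots> \<le> P * (1 / N ^ 3 + 2 / N ^ 3 + 2 / N ^ 3)"
      using N6 P by (intro mult_left_mono add_mono divide_left_mono power_increasing) auto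
    also have "\<dots> = P * 5 / N ^ 3" by simp
    also have "\<dots> \<le> P * 5 / (20 * real b)"
    proof -
      have "6 * 6 * (3 * real b) \<le> N * N * N" using N6 bN by (intro mult_mono) auto
      then have "20 * real b \<le> N ^ 3" using b unfolding power3_eq_cube by linarith
      then show ?thesis using P b N6 by (intro divide_left_mono) auto
    qed
    also have "\<dots> = P / (4 * real b)" by simp
    finally show False using large by (simp add: y_def P_def)
  qed
  then obtain u v where uv: "u \<in> ?V" "v \<in> ?V" "y u - y v > (real q + 1) * T" by blast
  have uv': "y u > y v" using uv(3) T0 by (smt (verit) mult_nonneg_nonneg of_nat_0_le_iff)
  then have "\<exists>v\<in>?V. (ring_step b q ^^ k) x v \<noteq> 0" using uv by (auto simp: y_def intro: ccontr)
  from power_iterate_pos_scale[OF this] obtain c where c: "c > 0"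
    "power_iterate b q x k = (\<lambda>v. c * y v)" by (auto simp: y_def)
  show ?thesis
  proof (rule recovers_cliquesI[OF _ uv(1,2), where \<tau> = "c * T"])
    fix i j l assume "i < q" "j \<in> vertex_block b i" "l \<in> vertex_block b i"
    from block[OF this] have "y j - y l \<le> T" by linarith
    then show "power_iterate b q x k j - power_iterate b q x k l \<le> c * T"
      using c by (simp flip: right_diff_distrib)
  next
    have "c * (y u - y v) > c * ((real q + 1) * T)" using uv c by simp
    then show "(real q + 1) * (c * T) < power_iterate b q x k u - power_iterate b q x k v"
      by (simp add: c(2) algebra_simps)
  qed (use b c uv' in auto)
qed

subsection \<open>Gaussian estimates\<close>

lemma std_normal_density_le_half: "std_normal_density x \<le> 1 / 2"
proof -
  have "2 \<le> sqrt (2 * pi)" using pi_ge_two by (intro real_le_rsqrt) auto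
  then have "1 / sqrt (2 * pi) \<le> 1 / 2" by (intro divide_left_mono) auto
  moreover have "1 / sqrt (2 * pi) * exp (- x\<^sup>2 / 2) \<le> 1 / sqrt (2 * pi) * 1"
    by (intro mult_left_mono) auto
  ultimately show ?thesis unfolding std_normal_density_def by linarith
qed

text \<open>The interval has length 1 and the density is at most 1/2; this is the source of the base
  1/2 in the anticoncentration bound.\<close>

lemma std_normal_interval_le:
  "emeasure std_normal_distribution {c - 1/2..c + 1/2} \<le> ennreal (1/2)"
proof -
  have "emeasure std_normal_distribution {c - 1/2..c + 1/2} =
      (\<integral>\<^sup>+x. ennreal (std_normal_density x) * indicator {c - 1/2..c + 1/2} x \<partial>lborel)"
    by (simp add: emeasure_density)
  also have "\<dots> \<le> (\<integral>\<^sup>+x. ennreal (1/2) * indicator {c - 1/2..c + 1/2} x \<partial>lborel)"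
    by (intro nn_integral_mono mult_right_mono ennreal_leI std_normal_density_le_half) auto
  also have "\<dots> = ennreal (1/2)" by (subst nn_integral_cmult_indicator) auto
  finally show ?thesis .
qed

text \<open>Half of the exponent is spent on the bound \<open>exp (- a\<^sup>2 / 4)\<close>; the
  other half, \<open>exp (- x\<^sup>2 / 4)\<close>, is integrable as a multiple of the density of
  variance 2.\<close>

lemma std_normal_tail_le:
  assumes "a \<ge> 0"
  shows "emeasure std_normal_distribution {x. \<bar>x\<bar> > a} \<le> ennreal (sqrt 2 * exp (- a\<^sup>2 / 4))"
proof -
  let ?K = "sqrt 2 * exp (- a\<^sup>2 / 4)"
  have meas[measurable]: "{x::real. \<bar>x\<bar> > a} \<in> sets borel" by measurable
  have le: "std_normal_density x \<le> ?K * normal_density 0 (sqrt 2) x" if "\<bar>x\<bar> > a" for x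
  proof -
    have "a\<^sup>2 \<le> x\<^sup>2" using that assms by (metis abs_le_square_iff abs_of_nonneg less_imp_le)
    then have "exp (- x\<^sup>2 / 2) \<le> exp (- a\<^sup>2 / 4) * exp (- x\<^sup>2 / 4)"
      unfolding exp_add[symmetric] by simp
    then have "1 / sqrt (2 * pi) * exp (- x\<^sup>2 / 2) \<le>
        1 / sqrt (2 * pi) * (exp (- a\<^sup>2 / 4) * exp (- x\<^sup>2 / 4))"
      by (intro mult_left_mono) auto
    also have "\<dots> = ?K * normal_density 0 (sqrt 2) x"
      by (simp add: normal_density_def real_sqrt_mult field_simps)
    finally show ?thesis unfolding std_normal_density_def .
  qed
  have "emeasure std_normal_distribution {x. \<bar>x\<bar> > a} =
      (\<integral>\<^sup>+x. ennreal (std_normal_density x) * indicator {x. \<bar>x\<bar> > a} x \<partial>lborel)"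
    by (simp add: emeasure_density)
  also have "\<dots> \<le> (\<integral>\<^sup>+x. ennreal ?K * ennreal (normal_density 0 (sqrt 2) x) \<partial>lborel)"
    using le by (intro nn_integral_mono) (auto simp: indicator_def ennreal_leI simp flip: ennreal_mult)
  also have "\<dots> = ennreal ?K"
    by (simp add: nn_integral_cmult nn_integral_eq_integral)
  finally show ?thesis .
qed

lemma prob_space_std_normal: "prob_space std_normal_distribution"
  by (rule prob_space_normal_density) simp

lemma product_prob_space_std_normal: "product_prob_space (\<lambda>_. std_normal_distribution)"
  by (intro product_prob_spaceI prob_space_std_normal)

lemma gaussian_tail_le:
  assumes "finite V" "a \<ge> 0"
  shows "emeasure (PiM V (\<lambda>_. std_normal_distribution))
      {x \<in> space (PiM V (\<lambda>_. std_normal_distribution)). \<exists>v\<in>V. \<bar>x v\<bar> > a} \<le>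
    ennreal (real (card V) * (sqrt 2 * exp (- a\<^sup>2 / 4)))"
proof -
  let ?G = "PiM V (\<lambda>_. std_normal_distribution)"
  interpret P: product_prob_space "\<lambda>_. std_normal_distribution" V
    by (rule product_prob_space_std_normal)
  let ?E = "\<lambda>v. {x \<in> space ?G. x v \<in> {r. \<bar>r\<bar> > a}}"
  have [measurable]: "{r::real. \<bar>r\<bar> > a} \<in> sets borel" by measurable
  have E: "emeasure ?G (?E v) \<le> ennreal (sqrt 2 * exp (- a\<^sup>2 / 4))" if "v \<in> V" for v
    using std_normal_tail_le[OF assms(2)] that by (subst P.emeasure_PiM_Collect_single) auto
  have eq: "{x \<in> space ?G. \<exists>v\<in>V. \<bar>x v\<bar> > a} = (\<Union>v\<in>V. ?E v)" by auto
  have "emeasure ?G (\<Union>v\<in>V. ?E v) \<le> (\<Sum>v\<in>V. emeasure ?G (?E v))"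
    using assms(1) by (intro emeasure_subadditive_finite) auto
  also have "\<dots> \<le> of_nat (card V) * ennreal (sqrt 2 * exp (- a\<^sup>2 / 4))"
    by (rule sum_bounded_above) (erule E)
  also have "of_nat (card V) = ennreal (real (card V))"
    by (rule ennreal_of_nat_eq_real_of_nat)
  also have "ennreal (real (card V)) * ennreal (sqrt 2 * exp (- a\<^sup>2 / 4)) =
      ennreal (real (card V) * (sqrt 2 * exp (- a\<^sup>2 / 4)))"
    by (rule ennreal_mult[symmetric]) auto
  finally show ?thesis unfolding eq .
qed

text \<open>Fix the coordinates outside \<open>J\<close>. A nonempty section of \<open>W\<close>
  lies in the cube of side 1 around any one of its points, which has mass at most 1/2 per
  coordinate; Fubini integrates this bound over the fixed coordinates.\<close>

lemma gaussian_small_sections: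
  assumes V: "finite V" "J \<subseteq> V" and W: "W \<in> sets (PiM V (\<lambda>_. std_normal_distribution))"
    and close: "\<And>x y j. x \<in> W \<Longrightarrow> y \<in> W \<Longrightarrow> (\<And>v. v \<in> V - J \<Longrightarrow> x v = y v) \<Longrightarrow> j \<in> J \<Longrightarrow>
      \<bar>x j - y j\<bar> \<le> 1/2"
  shows "emeasure (PiM V (\<lambda>_. std_normal_distribution)) W \<le> ennreal ((1/2) ^ card J)"
proof -
  let ?G = "\<lambda>I. PiM I (\<lambda>_. std_normal_distribution)"
  interpret P: product_prob_space "\<lambda>_. std_normal_distribution" J
    by (rule product_prob_space_std_normal)
  let ?I = "V - J"
  have J: "finite J" using V finite_subset by blast
  have VIJ: "?I \<union> J = V" using V by auto
  let ?S = "\<lambda>x. (\<lambda>y. merge ?I J (x, y)) -` W \<inter> space (?G J)"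
  have small: "emeasure (?G J) (?S x) \<le> ennreal ((1/2) ^ card J)" for x
  proof (cases "?S x = {}")
    case True
    then show ?thesis by simp
  next
    case False
    then obtain y where y: "y \<in> ?S x" by blast
    have "?S x \<subseteq> (\<Pi>\<^sub>E j\<in>J. {y j - 1/2..y j + 1/2})"
    proof
      fix z assume z: "z \<in> ?S x"
      have d: "\<bar>z j - y j\<bar> \<le> 1/2" if "j \<in> J" for j
        using close[of "merge ?I J (x, z)" "merge ?I J (x, y)" j] y z that by (simp add: merge_def)
      have "z j \<in> {y j - 1/2..y j + 1/2}" if "j \<in> J" for j
        using d[OF that] unfolding abs_le_iff atLeastAtMost_iff by linarith
      then show "z \<in> (\<Pi>\<^sub>E j\<in>J. {y j - 1/2..y j + 1/2})"
        using z by (auto simp: space_PiM PiE_iff)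
    qed
    then have "emeasure (?G J) (?S x) \<le> emeasure (?G J) (\<Pi>\<^sub>E j\<in>J. {y j - 1/2..y j + 1/2})"
      using J by (intro emeasure_mono sets_PiM_I_finite) auto
    also have "\<dots> = (\<Prod>j\<in>J. emeasure std_normal_distribution {y j - 1/2..y j + 1/2})"
      using J by (intro P.emeasure_PiM) auto
    also have "\<dots> \<le> (\<Prod>j\<in>J. ennreal (1/2))"
      by (intro prod_mono_ennreal std_normal_interval_le)
    also have "\<dots> = ennreal ((1/2) ^ card J)"
      unfolding prod_constant by (rule ennreal_power) simp
    finally show ?thesis .
  qed
  have "emeasure (?G V) W = (\<integral>\<^sup>+x. emeasure (?G J) (?S x) \<partial>?G ?I)"
    by (rule P.emeasure_fold_integral[of ?I J W, unfolded VIJ]) (use V J W in auto)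
  also have "\<dots> \<le> (\<integral>\<^sup>+x. ennreal ((1/2) ^ card J) \<partial>?G ?I)"
    by (intro nn_integral_mono small)
  also have "\<dots> = ennreal ((1/2) ^ card J)"
    by (simp add: prob_space.emeasure_space_1[OF prob_space_PiM[OF prob_space_std_normal]])
  finally show ?thesis .
qed

text \<open>Each summand is compared separately. Since \<open>exp (7/8) >= 2\<close>, the first base
  is at least 1/4, and \<open>(1/4) powr (q/2) = (1/2) ^ q\<close>. The Gaussian tail is quadratic
  in the exponent, so it beats the second term.\<close>

lemma failure_bound_ge:
  assumes b: "b \<ge> 2" and q: "q \<ge> 3"
  shows "(1/2) ^ q + real (b * q) * (sqrt 2 * exp (- (real (b * q))\<^sup>2 / 4)) \<le> failure_bound b q"
proof -
  define N where "N = real (b * q)"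
  have "2 * 3 \<le> real b * real q" using b q by (intro mult_mono) auto
  then have N6: "N \<ge> 6" by (simp add: N_def)
  then have NN: "6 * N \<le> N * N" by (intro mult_right_mono) auto
  have "(2::real) \<le> exp (7/8)"
    using exp_lower_Taylor_quadratic[of "7/8::real"] by (simp add: power2_eq_square)
  then have "(1/4) powr (real q / 2) \<le> (exp (7/8) / 8) powr (real q / 2)"
    by (intro powr_mono2) auto
  moreover have "(1/4) powr (real q / 2) = (1/2::real) ^ q"
  proof -
    have quarter: "(1/4::real) = (1/2) powr 2" by (simp add: power2_eq_square)
    have "(1/4) powr (real q / 2) = ((1/2::real) powr 2) powr (real q / 2)"
      by (simp only: quarter)
    also have "\<dots> = (1/2) powr real q" unfolding powr_powr by simp
    finally show ?thesis by (simp add: powr_realpow)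
  qed
  ultimately have first: "(1/2) ^ q \<le> (exp (7/8) / 8) powr (real q / 2)" by simp
  have "sqrt 2 \<le> 3" by (rule real_le_lsqrt) auto
  then have "N * sqrt 2 \<le> N * 3" using N6 by (intro mult_left_mono) auto
  also have "\<dots> \<le> 1 + N + N\<^sup>2 / 2"
    unfolding power2_eq_square using NN N6 by linarith
  also have "\<dots> \<le> exp N" using N6 by (intro exp_lower_Taylor_quadratic) auto
  finally have "N * sqrt 2 \<le> exp N" .
  then have "N * sqrt 2 * exp (- N\<^sup>2 / 4) \<le> exp N * exp (- N\<^sup>2 / 4)"
    by (intro mult_right_mono) auto
  also have "\<dots> = exp (N - N\<^sup>2 / 4)" by (simp add: exp_add[symmetric])
  also have "\<dots> \<le> exp (- ((N - real q) / 2))"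
  proof -
    \<comment> \<open>From \<open>N >= 6\<close> the quadratic term is at least
      \<open>3/2 * N\<close>, so the left side is at most \<open>- N / 2\<close>.\<close>
    have "N - N\<^sup>2 / 4 \<le> - ((N - real q) / 2)"
      unfolding power2_eq_square using NN N6 of_nat_0_le_iff[of q, where 'a=real] by argo
    then show ?thesis by simp
  qed
  also have "\<dots> = (exp (-1)) powr ((N - real q) / 2)"
    by (simp add: powr_def)
  also have "\<dots> \<le> (2 / exp 1) powr ((N - real q) / 2)"
    using b q by (intro powr_mono2) (auto simp: N_def exp_minus field_simps)
  finally have "N * (sqrt 2 * exp (- N\<^sup>2 / 4)) \<le> (2 / exp 1) powr ((N - real q) / 2)"
    by (simp add: mult.assoc)
  with first show ?thesis unfolding failure_bound_def N_def by simp
qed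

subsection \<open>Measurability and anticoncentration\<close>

lemma mat_app_pow_measurable:
  assumes "u \<in> V"
  shows "(\<lambda>x. (mat_app V H ^^ k) x u) \<in> borel_measurable (PiM V (\<lambda>_. std_normal_distribution))"
  using assms
proof (induction k arbitrary: u)
  case 0
  then show ?case by simp
next
  case (Suc k)
  then show ?case by (auto simp: mat_app_def intro!: borel_measurable_sum borel_measurable_times)
qed

lemma power_iterate_measurable:
  assumes "u \<in> ring_verts b q"
  shows "(\<lambda>x. power_iterate b q x k u) \<in> borel_measurable (gaussian_vector b q)"
  using assms
proof (induction k arbitrary: u)
  case 0
  then show ?case by (simp add: gaussian_vector_def)
next
  case (Suc k)
  then show ?case
    by (auto simp: L2_set_def intro!: borel_measurable_divide borel_measurable_sum borel_measurable_times
        measurable_compose[OF _ borel_measurable_sqrt] borel_measurable_power)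
qed

text \<open>Moving the threshold down without passing the largest entry below it changes no
  comparison \<open>y v < t\<close>. A rational threshold therefore suffices, which turns the event
  into a countable union.\<close>

lemma recovers_cliques_iff_rational:
  assumes "b \<ge> 1" "q \<ge> 1"
  shows "recovers_cliques b q y \<longleftrightarrow> (\<exists>s::rat.
      (\<exists>v\<in>ring_verts b q. y v < of_rat s) \<and> (\<exists>v\<in>ring_verts b q. of_rat s < y v) \<and>
      (\<forall>i\<in>{..<q}. \<forall>j\<in>vertex_block b i. \<forall>l\<in>vertex_block b i. y j < of_rat s \<longleftrightarrow> y l < of_rat s))"
    (is "?L \<longleftrightarrow> ?R")
proof -
  let ?V = "ring_verts b q"
  have "1 \<in> ?V" using assms by (simp add: ring_verts_def)
  then have ne: "y ` ?V \<noteq> {}" by blast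
  have MinMax: "Min (y ` ?V) < t \<longleftrightarrow> (\<exists>v\<in>?V. y v < t)" "t < Max (y ` ?V) \<longleftrightarrow> (\<exists>v\<in>?V. t < y v)" for t
    using ne by (auto simp: Min_less_iff Max_gr_iff)
  show ?thesis
  proof
    assume ?L
    then obtain t where t: "\<exists>v\<in>?V. y v < t" "\<exists>v\<in>?V. t < y v"
      "\<And>i j l. i < q \<Longrightarrow> j \<in> vertex_block b i \<Longrightarrow> l \<in> vertex_block b i \<Longrightarrow> y j < t \<longleftrightarrow> y l < t"
      unfolding recovers_cliques_def MinMax by blast
    define m where "m = Max {y v | v. v \<in> ?V \<and> y v < t}"
    have fin: "finite {y v | v. v \<in> ?V \<and> y v < t}" by simp
    have "m \<in> {y v | v. v \<in> ?V \<and> y v < t}"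
      unfolding m_def using t(1) by (intro Max_in fin) auto
    then have "m < t" by auto
    have m: "y v \<le> m" if "v \<in> ?V" "y v < t" for v
      unfolding m_def using that by (intro Max_ge fin) auto
    obtain s where r: "m < of_rat s" "of_rat s < t"
      using Rats_dense_in_real[OF \<open>m < t\<close>] by (auto elim: Rats_cases)
    let ?r = "of_rat s :: real"
    have eq: "y v < ?r \<longleftrightarrow> y v < t" if "v \<in> ?V" for v
      using m[OF that] r by fastforce
    have block: "v \<in> ?V" if "i < q" "v \<in> vertex_block b i" for i v
      using that assms clique_eq_insert_corner[of b i] by (auto simp: ring_verts_UN)
    show ?R
    proof (intro exI[of _ s] conjI ballI)
      show "\<exists>v\<in>?V. y v < ?r" using t(1) eq by blast
      show "\<exists>v\<in>?V. ?r < y v" using t(2) r(2) by (meson less_trans)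
      fix i j l assume "i \<in> {..<q}" "j \<in> vertex_block b i" "l \<in> vertex_block b i"
      then show "y j < ?r \<longleftrightarrow> y l < ?r" using t(3)[of i j l] block eq by simp
    qed
  next
    assume ?R
    then show ?L unfolding recovers_cliques_def MinMax by (metis lessThan_iff)
  qed
qed

lemma recovers_cliques_measurable:
  assumes "b \<ge> 1" "q \<ge> 1"
  shows "{x \<in> space (gaussian_vector b q). recovers_cliques b q (power_iterate b q x k)} \<in>
    sets (gaussian_vector b q)"
proof -
  have block: "v \<in> ring_verts b q" if "i < q" "v \<in> vertex_block b i" for i v
    using that assms clique_eq_insert_corner[of b i] by (auto simp: ring_verts_UN)
  have M[measurable]: "Measurable.pred (gaussian_vector b q) (\<lambda>x. power_iterate b q x k v < t)"
    "Measurable.pred (gaussian_vector b q) (\<lambda>x. t < power_iterate b q x k v)"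
    if "v \<in> ring_verts b q" for v t
    using power_iterate_measurable[OF that, of k] by (auto intro!: borel_measurable_const borel_measurable_pred_less)
  have "Measurable.pred (gaussian_vector b q) (\<lambda>x. recovers_cliques b q (power_iterate b q x k))"
    unfolding recovers_cliques_iff_rational[OF assms]
    by (intro pred_intros_countable pred_intros_finite pred_intros_logic M
        finite_ring_verts finite_vertex_block finite_lessThan) (auto intro: block)
  then show ?thesis by simp
qed

text \<open>The factor 4 leaves \<open>mu b ^ k / (2 * real b)\<close> for a difference of two
  elements of \<open>W\<close>. The factor \<open>b\<close> pays for the \<open>b - 1\<close> lost
  when a single entry is replaced by its block average, so that entries differ by at most
  1/2.\<close>

lemma gaussian_iterate_small:
  fixes k :: nat
  assumes b: "b \<ge> 2" and q: "q \<ge> 3" and mu: "mu b > 0"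
  defines "W \<equiv> {x \<in> space (gaussian_vector b q).
      L2_set ((ring_step b q ^^ k) x) (ring_verts b q) \<le> mu b ^ k / (4 * real b)}"
  shows "W \<in> sets (gaussian_vector b q)"
    and "emeasure (gaussian_vector b q) W \<le> ennreal ((1/2) ^ q)"
proof -
  let ?V = "ring_verts b q" and ?A = "ring_step b q"
  have m[measurable]: "(\<lambda>x. L2_set ((?A ^^ k) x) ?V) \<in> borel_measurable (gaussian_vector b q)"
    unfolding L2_set_def gaussian_vector_def
    by (intro measurable_compose[OF _ borel_measurable_sqrt] borel_measurable_sum borel_measurable_power mat_app_pow_measurable)
  show W: "W \<in> sets (gaussian_vector b q)" unfolding W_def by measurable
  \<comment> \<open>The first internal vertex of every block. For a difference supported on
    \<open>J\<close>, each block sum is a single entry.\<close>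
  define J where "J = (\<lambda>i. i * b + 2) ` {..<q}"
  have block: "v \<in> ?V" if "i < q" "v \<in> vertex_block b i" for i v
    using that b clique_eq_insert_corner[of b i] by (auto simp: ring_verts_UN)
  have repr: "i * b + 2 \<in> vertex_block b i" for i using b by (simp add: vertex_block_def)
  have J: "J \<subseteq> ?V" using block repr by (auto simp: J_def)
  have "card J = q" using b unfolding J_def by (subst card_image) (auto simp: inj_on_def)
  moreover have "\<bar>x j - y j\<bar> \<le> 1/2"
    if xy: "x \<in> W" "y \<in> W" and agree: "\<And>v. v \<in> ?V - J \<Longrightarrow> x v = y v" and j: "j \<in> J" for x y j
  proof -
    define d where "d v = x v - y v" for v
    obtain i0 where i0: "i0 < q" "j = i0 * b + 2" using j by (auto simp: J_def)
    have block_J: "v = i * b + 2" if "v \<in> vertex_block b i" "v \<in> J" for v i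
    proof -
      obtain i' where i': "v = i' * b + 2" using \<open>v \<in> J\<close> by (auto simp: J_def)
      have "v \<in> clique b i" "v \<in> clique b i'"
        using that(1) repr[of i'] i' b by (auto simp: clique_eq_insert_corner)
      then show ?thesis using clique_unique[of b v i i'] b i' by simp
    qed
    have corner0: "d (corner b i) = 0" if "i < q" for i
    proof -
      have "corner b i \<in> ?V" using that b by (auto simp: ring_verts_UN clique_eq_insert_corner)
      moreover have "corner b i \<noteq> i' * b + 2" for i'
        using corner_notin_any_block[of b i i'] repr[of i'] b by force
      then have "corner b i \<notin> J" unfolding J_def by blast
      ultimately show ?thesis using agree by (simp add: d_def)
    qed
    have sum_d: "sum d (vertex_block b i) = d (i * b + 2)" if "i < q" for i
    proof -
      have "sum d (vertex_block b i) = sum d {i * b + 2}"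
      proof (rule sum.mono_neutral_right)
        show "\<forall>v\<in>vertex_block b i - {i * b + 2}. d v = 0"
          using block[OF that] block_J agree by (auto simp: d_def)
      qed (use repr in auto)
      then show ?thesis by simp
    qed
    have "d = (\<lambda>v. x v - y v)" by (simp add: d_def fun_eq_iff)
    then have Ad: "(?A ^^ k) d = (\<lambda>v. (?A ^^ k) x v - (?A ^^ k) y v)"
      by (simp only: mat_app_pow_diff)
    have "L2_set (\<lambda>v. (?A ^^ k) x v + - (?A ^^ k) y v) ?V \<le>
        L2_set ((?A ^^ k) x) ?V + L2_set (\<lambda>v. - (?A ^^ k) y v) ?V"
      by (rule L2_set_triangle_ineq)
    also have "L2_set (\<lambda>v. - (?A ^^ k) y v) ?V = L2_set ((?A ^^ k) y) ?V"
      by (simp add: L2_set_def)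
    finally have "L2_set ((?A ^^ k) d) ?V \<le> L2_set ((?A ^^ k) x) ?V + L2_set ((?A ^^ k) y) ?V"
      unfolding Ad by simp
    then have le: "L2_set ((?A ^^ k) d) ?V \<le> mu b ^ k / (2 * real b)"
      using xy by (simp add: W_def)
    let ?f = "\<lambda>i. (sum d (vertex_block b i))\<^sup>2 / (real b - 1)"
    have "(d j)\<^sup>2 / (real b - 1) = ?f i0" using i0 sum_d by simp
    also have "\<dots> \<le> sum ?f {..<q}" using i0 b by (intro member_le_sum) auto
    finally have "growth b ^ k * ((d j)\<^sup>2 / (real b - 1)) \<le> growth b ^ k * sum ?f {..<q}"
      using growth_nonneg[of b] by (intro mult_left_mono) auto
    also have "\<dots> \<le> (\<Sum>u\<in>?V. ((?A ^^ k) d u)\<^sup>2)"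
      by (intro internal_growth b q corner0)
    also have "\<dots> = (L2_set ((?A ^^ k) d) ?V)\<^sup>2"
      by (simp add: L2_set_def sum_nonneg)
    also have "\<dots> \<le> (mu b ^ k / (2 * real b))\<^sup>2"
      using le by (intro power_mono L2_set_nonneg)
    also have "\<dots> = growth b ^ k * (1 / (2 * real b))\<^sup>2"
    proof -
      have "(mu b ^ k)\<^sup>2 = ((mu b)\<^sup>2) ^ k" by (simp add: mult.commute flip: power_mult)
      also have "(mu b)\<^sup>2 = growth b" by (simp add: mu_def growth_nonneg)
      finally show ?thesis by (simp add: power_divide)
    qed
    finally have "growth b ^ k * ((d j)\<^sup>2 / (real b - 1)) \<le> growth b ^ k * (1 / (2 * real b))\<^sup>2" .
    moreover have "growth b ^ k > 0" using mu by (simp add: mu_def)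
    ultimately have "(d j)\<^sup>2 / (real b - 1) \<le> (1 / (2 * real b))\<^sup>2"
      by (rule mult_left_le_imp_le)
    then have "(d j)\<^sup>2 \<le> (1 / (2 * real b))\<^sup>2 * (real b - 1)"
      using b by (simp add: divide_le_eq)
    also have "\<dots> \<le> (1 / (2 * real b))\<^sup>2 * (real b)\<^sup>2"
    proof (rule mult_left_mono)
      have "real b * 1 \<le> real b * real b" using b by (intro mult_left_mono) auto
      then show "real b - 1 \<le> (real b)\<^sup>2" unfolding power2_eq_square by linarith
    qed simp
    also have "\<dots> = (1/2)\<^sup>2" using b by (simp add: power2_eq_square)
    finally show ?thesis unfolding abs_le_square_iff[symmetric] by (simp add: d_def)
  qed
  ultimately show "emeasure (gaussian_vector b q) W \<le> ennreal ((1/2) ^ q)"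
    using gaussian_small_sections[OF finite_ring_verts J W[unfolded gaussian_vector_def]]
    by (simp add: gaussian_vector_def)
qed

subsection \<open>Convergence rate\<close>

lemma rate_squared:
  assumes b: "b \<ge> 2"
  shows "(real b powr (-1/4) * mu b)\<^sup>2 = growth b / sqrt (real b)"
proof -
  have "(real b powr (-1/4))\<^sup>2 = real b powr (-1/4 + -1/4)"
    using b by (simp add: powr_add[symmetric] power2_eq_square)
  also have "\<dots> = 1 / sqrt (real b)" using b by (simp add: powr_minus_divide powr_half_sqrt)
  finally show ?thesis by (simp add: power_mult_distrib mu_def growth_nonneg)
qed

text \<open>Relative to the signal \<open>mu b\<close>, the noise shrinks by at least
  \<open>b powr (1/4)\<close> in each step. A number of steps proportional to
  \<open>1 + log b q\<close> thus gains any fixed power of \<open>b * q\<close>.\<close>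

lemma block_noise_le_rate:
  assumes b: "b \<ge> 3"
  shows "1 / (real b - 1) \<le> real b powr (-1/4) * mu b"
proof (rule power2_le_imp_le)
  define B where "B = real b - 1"
  have B: "B \<ge> 2" using b by (simp add: B_def)
  have "sqrt (real b) \<le> B\<^sup>2 * growth b"
  \<comment> \<open>The bound \<open>(B - 1)\<^sup>2\<close> from the second summand of
    \<open>growth\<close> is only 1 at \<open>b = 3\<close>; there the corner summand is needed as
    well, giving the exact value 2.\<close>
  proof (cases "b = 3")
    case True
    have "sqrt 3 \<le> (2::real)" by (rule real_le_lsqrt) auto
    then show ?thesis using True by (simp add: B_def growth_def power2_eq_square)
  next
    case False
    then have b4: "real b \<ge> 4" using b by simp
    have "sqrt (real b) \<le> real b / 2"
      using b4 mult_right_mono[OF b4, of "real b"] by (intro real_le_lsqrt) (auto simp: power2_eq_square)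
    also have "\<dots> \<le> (B - 1) * 1" using b4 by (simp add: B_def)
    also have "\<dots> \<le> (B - 1) * (B - 1)" using b4 by (intro mult_left_mono) (auto simp: B_def)
    also have "\<dots> = B\<^sup>2 * ((B - 1) / B)\<^sup>2" using B by (simp add: power2_eq_square)
    also have "\<dots> \<le> B\<^sup>2 * growth b"
      by (intro mult_left_mono) (auto simp: growth_def B_def)
    finally show ?thesis .
  qed
  then have "1 / B\<^sup>2 \<le> growth b / sqrt (real b)"
    using B b by (simp add: field_simps)
  then show "(1 / (real b - 1))\<^sup>2 \<le> (real b powr (-1/4) * mu b)\<^sup>2"
    using rate_squared[of b] b by (simp add: B_def power_divide)
qed (simp add: mu_def growth_nonneg)

text \<open>For \<open>b >= 3\<close> the eigenvalue is dominated by the block noise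
  \<open>1 / (b - 1)\<close>. For \<open>b = 2\<close> that noise is too large, but the eigenvalue
  is \<open>-1/3\<close> and \<open>growth 2 = 1/3\<close>, so a direct check works.\<close>

lemma abs_bottom_val_le_rate:
  assumes b: "b \<ge> 2"
  shows "\<bar>bottom_val b\<bar> \<le> real b powr (-1/4) * mu b"
proof (cases "b = 2")
  case True
  have "sqrt 2 \<le> (3::real)" by (rule real_le_lsqrt) auto
  then have "(1/3)\<^sup>2 \<le> growth 2 / sqrt 2" by (simp add: growth_def power2_eq_square field_simps)
  then have "(1/3)\<^sup>2 \<le> (real 2 powr (-1/4) * mu 2)\<^sup>2" using rate_squared[of 2] by simp
  then have "1/3 \<le> real 2 powr (-1/4) * mu 2"
    by (rule power2_le_imp_le) (simp add: mu_def growth_nonneg)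
  then show ?thesis using True by (simp add: bottom_val_def)
next
  case False
  then have b3: "b \<ge> 3" using b by simp
  have "\<bar>bottom_val b\<bar> = (real b - 3) / (real b + 1) * (1 / (real b - 1))"
    using b3 by (simp add: bottom_val_def)
  also have "\<dots> \<le> 1 * (1 / (real b - 1))" using b3 by (intro mult_right_mono) auto
  also have "\<dots> \<le> real b powr (-1/4) * mu b" using block_noise_le_rate[OF b3] by simp
  finally show ?thesis .
qed

lemma rate_power_le:
  assumes b: "b \<ge> 2" and q: "q \<ge> 1" and k: "real k \<ge> 48 * (1 + log (real b) (real q))"
    and c: "0 \<le> c" "c \<le> real b powr (-1/4) * m"
  shows "c ^ k \<le> m ^ k / real (b * q) ^ 12"
proof -
  have rb: "real b > 1" using b by simp
  have N: "real (b * q) = real b powr (1 + log (real b) (real q))"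
    using rb q by (simp add: powr_add)
  have "c ^ k \<le> (real b powr (-1/4)) ^ k * m ^ k"
    using power_mono[OF c(2,1), of k] by (simp add: power_mult_distrib)
  moreover have "(real b powr (-1/4)) ^ k = real b powr (- real k / 4)"
    using rb by (simp add: powr_power)
  \<comment> \<open>The constant 48 is 4 times 12: a quarter power of \<open>b\<close> is gained per
    step and the twelfth power of \<open>b * q\<close> is wanted.\<close>
  moreover have "\<dots> \<le> real b powr (- (12 * (1 + log (real b) (real q))))"
    using k rb by (intro powr_mono) auto
  moreover have "\<dots> = 1 / real (b * q) ^ 12"
  proof -
    have "real (b * q) ^ 12 = real b powr (12 * (1 + log (real b) (real q)))"
      unfolding N using rb by (simp add: powr_power)
    then show ?thesis by (simp only: powr_minus_divide)
  qed
  moreover have "0 \<le> m"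
  proof (rule ccontr)
    assume "\<not> 0 \<le> m"
    then have "real b powr (-1/4) * m < 0" using rb by (intro mult_pos_neg) auto
    then show False using c by linarith
  qed
  then have "m ^ k \<ge> 0" by simp
  ultimately have "c ^ k \<le> 1 / real (b * q) ^ 12 * m ^ k"
    by (smt (verit) mult_right_mono)
  then show ?thesis by simp
qed

lemma prob_recovers_cliques:
  assumes b: "b \<ge> 2" and q: "q \<ge> 3" and k: "real k \<ge> 48 * (1 + log (real b) (real q))"
  shows "\<P>(x0 in gaussian_vector b q. recovers_cliques b q (power_iterate b q x0 k)) \<ge> 1 - failure_bound b q"
proof -
  let ?G = "gaussian_vector b q" and ?V = "ring_verts b q"
  interpret G: prob_space ?G
    unfolding gaussian_vector_def by (intro prob_space_PiM prob_space_std_normal)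
  define R where "R = {x \<in> space ?G. recovers_cliques b q (power_iterate b q x k)}"
  define W where "W = {x \<in> space ?G. L2_set ((ring_step b q ^^ k) x) ?V \<le> mu b ^ k / (4 * real b)}"
  define U where "U = {x \<in> space ?G. \<exists>v\<in>?V. \<bar>x v\<bar> > real (b * q)}"
  have "growth b > 0" using b by (auto simp: growth_def intro!: add_pos_nonneg)
  then have mu: "mu b > 0" by (simp add: mu_def)
  have R: "R \<in> sets ?G" unfolding R_def using b q by (intro recovers_cliques_measurable) auto
  have W: "W \<in> sets ?G" "emeasure ?G W \<le> ennreal ((1/2) ^ q)"
    unfolding W_def by (rule gaussian_iterate_small[OF b q mu])+
  have "U = (\<Union>v\<in>?V. {x \<in> space ?G. \<bar>x v\<bar> > real (b * q)})" by (auto simp: U_def)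
  also have "\<dots> \<in> sets ?G"
    unfolding gaussian_vector_def
    by (intro sets.finite_UN finite_ring_verts borel_measurable_less borel_measurable_const
        borel_measurable_abs) simp
  finally have U: "U \<in> sets ?G" .
  have "emeasure ?G U \<le> ennreal (real (b * q) * (sqrt 2 * exp (- (real (b * q))\<^sup>2 / 4)))"
    using gaussian_tail_le[of ?V "real (b * q)"] by (simp add: U_def gaussian_vector_def ring_verts_def)
  then have probU: "G.prob U \<le> real (b * q) * (sqrt 2 * exp (- (real (b * q))\<^sup>2 / 4))"
    by (simp add: G.emeasure_eq_measure)
  have probW: "G.prob W \<le> (1/2) ^ q"
    using W(2) by (simp add: G.emeasure_eq_measure)
  have "space ?G - R \<subseteq> W \<union> U"
  proof
    fix x assume x: "x \<in> space ?G - R"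
    show "x \<in> W \<union> U"
    proof (rule ccontr)
      assume nx: "x \<notin> W \<union> U"
      have "recovers_cliques b q (power_iterate b q x k)"
      proof (rule recovers_cliques_power_iterate[OF b q _ _ mu])
        show "\<bar>x v\<bar> \<le> real (b * q)" if "v \<in> ?V" for v
          using that x nx unfolding U_def by (force simp: not_less)
        show "mu b ^ k / (4 * real b) < L2_set ((ring_step b q ^^ k) x) ?V"
          using x nx unfolding W_def by auto
        show "\<bar>bottom_val b\<bar> ^ k \<le> mu b ^ k / real (b * q) ^ 12"
          using q by (intro rate_power_le[OF b _ k] abs_bottom_val_le_rate b) auto
        show "(1 / (real b - 1)) ^ k \<le> mu b ^ k / real (b * q) ^ 12" if "b \<ge> 3"
          using q that by (intro rate_power_le[OF b _ k] block_noise_le_rate) auto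
      qed
      then show False using x by (simp add: R_def)
    qed
  qed
  \<comment> \<open>Recovery is deterministic outside \<open>W\<close> (small iterate) and
    \<open>U\<close> (large starting entry), so a union bound finishes the estimate.\<close>
  then have "G.prob (space ?G - R) \<le> G.prob (W \<union> U)"
    using W U by (intro G.finite_measure_mono) auto
  also have "\<dots> \<le> G.prob W + G.prob U"
    using W U by (intro measure_Un_le) auto
  also have "\<dots> \<le> failure_bound b q"
    using probU probW failure_bound_ge[OF b q] by linarith
  finally show ?thesis using G.prob_compl[OF R] by (simp add: R_def)
qed

theorem theorem12:
  "\<exists>C::real. \<forall>b q::nat. b \<ge> 2 \<longrightarrow> q \<ge> 3 \<longrightarrow>
     (\<exists>kstar::nat. real kstar \<le> C * max 1 (log (real b) (real q)) \<and>
        (\<forall>k\<ge>kstar.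
           \<P>(x0 in gaussian_vector b q. recovers_cliques b q (power_iterate b q x0 k))
             \<ge> 1 - failure_bound b q))"
proof (intro exI[of _ "97::real"] allI impI)
  fix b q :: nat
  assume b: "b \<ge> 2" and q: "q \<ge> 3"
  define z where "z = 48 * (1 + log (real b) (real q))"
  define kstar where "kstar = nat \<lceil>z\<rceil>"
  have "log (real b) (real q) \<ge> 0" using b q by (simp add: zero_le_log_cancel_iff)
  then have "z \<ge> 0" by (simp add: z_def)
  then have "real kstar \<le> z + 1" unfolding kstar_def by linarith
  \<comment> \<open>Twice 48 from \<open>z\<close>, and 1 for rounding up.\<close>
  then have "real kstar \<le> 97 * max 1 (log (real b) (real q))"
    using max.cobounded1[of 1 "log (real b) (real q)"] max.cobounded2[of "log (real b) (real q)" 1]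
    unfolding z_def by argo
  moreover have "real k \<ge> z" if "k \<ge> kstar" for k
    using that unfolding kstar_def by linarith
  ultimately show "\<exists>kstar::nat. real kstar \<le> 97 * max 1 (log (real b) (real q)) \<and>
        (\<forall>k\<ge>kstar.
           \<P>(x0 in gaussian_vector b q. recovers_cliques b q (power_iterate b q x0 k))
             \<ge> 1 - failure_bound b q)"
    using prob_recovers_cliques[OF b q] unfolding z_def by blast
qed

end
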